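(* Let $\widehat V$ and $\widehat{BV}$ be the groups of right fractions of the Zappa–Szép product monoids $\mathcal F\bowtie S_\infty$ and $\mathcal F\bowtie B_\infty$, respectively. (I) Each element $x$ of $\widehat V$ or $\widehat{BV}$ is represented uniquely by a triple $(G,\alpha,H)$ satisfying the conditions: (a) $G$ and $H$ are in $\mathcal F$; (b) $\alpha$ is in $S_\infty$ if $x\in\widehat V$, and $\alpha$ is in $B_\infty$ if $x\in\widehat{BV}$; (c) $x=(G\alpha)(H)^{-1}$; (d) the length of $G$ is minimal among all triples satisfying (a)–(c). (II) With $(G,\alpha,H)$ the triple of (I), any other representative of $x$ (as a fraction of two elements of the monoid $\mathcal F\bowtie S_\infty$, respectively $\mathcal F\bowtie B_\infty$) is of the form $(G\alpha J\gamma)(HJ\gamma)^{-1}$ for some $J$ in $\mathcal F$ and some $\gamma$ in the appropriate one of $S_\infty$ or $B_\infty$. (III) The triple $(G,\alpha,H)$ of (I) is characterized (among triples satisfying (a) and (b)) by the fact that $x=G\alpha H^{-1}$ and that for no $G'$, $H'$ and $\lambda_i$ in $\mathcal F$ and $\alpha'$ in $S_\infty$ or $B_\infty$, as appropriate, is it true that $G\alpha=G'\alpha'\lambda_i$ and $H=H'\lambda_i$.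
   Context: Forests. $\mathbb N=\{0,1,2,\dots\}$. A tree is a finite non-empty set $T$ of finite strings over $\{0,1\}$, closed under taking prefixes, with $u0\in T$ if and only if $u1\in T$. Its leaves are the $u\in T$ with $u0,u1\notin T$, ordered left to right (lexicographically); $T$ is trivial if it consists only of the empty string. A forest is a sequence $F=(F_0,F_1,\dots)$ of trees, all but finitely many trivial. The leaves of $F$ are numbered $0,1,2,\dots$ so that all leaves of $F_i$ precede all leaves of $F_j$ when $i<j$, and leaves of one tree are ordered left to right. The product $FG$ attaches $G_j$ at the $j$-th leaf of $F$: $(FG)_i=F_i\cup\bigcup vG_j$, the union over leaves $v$ of $F_i$, where $j$ is the number of $v$ as a leaf of $F$ and $vG_j=\{vu\mid u\in G_j\}$. The set $\mathcal F$ of all forests is a monoid under this product, whose identity is the forest with all trees trivial. $\lambda_i$ denotes the forest whose only non-trivial tree is the $i$-th one, which consists of the empty string, $0$ and $1$. The $\lambda_i$ generate $\mathcal F$, and the length of a forest is the (well defined) number of factors in any expression of it as a product of $\lambda_i$'s. Permutations and braids. $S_\infty$ is the group of finitary permutations of $\mathbb N$, $\sigma_m$ is the transposition of $m$ and $m+1$, and $(\sigma\tau)(i)=\sigma(\tau(i))$. $B_\infty$ is the braid group on infinitely many strands: generators $\sigma_0,\sigma_1,\dots$, relations $\sigma_m\sigma_n=\sigma_n\sigma_m$ for $|m-n|\ge2$ and $\sigma_m\sigma_{m+1}\sigma_m=\sigma_{m+1}\sigma_m\sigma_{m+1}$. There is the standard surjection $B_\infty\to S_\infty$, $\sigma_m\mapsto\sigma_m$;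 for $\tau\in B_\infty$, $\tau(j)$ denotes the value at $j$ of the image of $\tau$. Zappa–Szép products. For $A=S_\infty$ or $A=B_\infty$ there are uniquely determined functions $A\times\mathcal F\to\mathcal F$, $(\alpha,u)\mapsto\alpha\cdot u$, and $A\times\mathcal F\to A$, $(\alpha,u)\mapsto\alpha^u$, satisfying, for all $\alpha,\beta\in A$, $u,v\in\mathcal F$: $(\alpha\beta)\cdot u=\alpha\cdot(\beta\cdot u)$, $(\alpha\beta)^u=\alpha^{(\beta\cdot u)}\beta^u$, $\alpha\cdot(uv)=(\alpha\cdot u)(\alpha^u\cdot v)$, $\alpha^{uv}=(\alpha^u)^v$, $\alpha^1=\alpha$, $1\cdot u=u$, $\alpha\cdot1=1$, $1^u=1$, and given on generators ($\epsilon=\pm1$) by $\sigma_q^\epsilon\cdot\lambda_m=\lambda_{\sigma_q(m)}$ and $(\sigma_q^\epsilon)^{\lambda_m}=\sigma_{q+1}^\epsilon$ if $m<q$; $\sigma_q^\epsilon\sigma_{q+1}^\epsilon$ if $m=q$; $\sigma_{q+1}^\epsilon\sigma_q^\epsilon$ if $m=q+1$; $\sigma_q^\epsilon$ if $m>q+1$. $\mathcal F\bowtie A$ is the set $\mathcal F\times A$ with product $(u,\alpha)(v,\beta)=(u(\alpha\cdot v),\alpha^v\beta)$, a monoid containing $\mathcal F$ and $A$ as submonoids via $u\mapsto(u,1)$, $\alpha\mapsto(1,\alpha)$; $(u,\alpha)$ is written $u\alpha$. The group of right fractions of a cancellative monoid $M$ in which any two elements have a common right multiple is the (unique up to isomorphism)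 group containing $M$ as a submonoid in which every element has the form $uv^{-1}$ with $u,v\in M$; the pair $(u,v)$ (or the expression $uv^{-1}$) is then called a representative of that element. The monoids $\mathcal F\bowtie S_\infty$ and $\mathcal F\bowtie B_\infty$ are cancellative with common right multiples. *)

theory Defs
  imports "HOL-Combinatorics.Transposition" "HOL-Algebra.Group"
begin

section \<open>Forests\<close>

text \<open>Strings over \<open>{0,1}\<close> are boolean lists, with \<open>False\<close> for \<open>0\<close> and \<open>True\<close> for \<open>1\<close>.\<close>

definition is_tree :: "bool list set \<Rightarrow> bool" where
  "is_tree T \<longleftrightarrow> finite T \<and> T \<noteq> {} \<and> (\<forall>u v. u @ v \<in> T \<longrightarrow> u \<in> T)
     \<and> (\<forall>u. u @ [False] \<in> T \<longleftrightarrow> u @ [True] \<in> T)"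

definition leaves :: "bool list set \<Rightarrow> bool list set" where
  "leaves T = {u \<in> T. u @ [False] \<notin> T \<and> u @ [True] \<notin> T}"

type_synonym forest = "nat \<Rightarrow> bool list set"

definition is_forest :: "forest \<Rightarrow> bool" where
  "is_forest F \<longleftrightarrow> (\<forall>i. is_tree (F i)) \<and> finite {i. F i \<noteq> {[]}}"

text \<open>The number of the leaf \<open>u\<close> of the tree \<open>F i\<close> is the number of leaves of \<open>F\<close> to its left.\<close>

definition leaf_number :: "forest \<Rightarrow> nat \<Rightarrow> bool list \<Rightarrow> nat" where
  "leaf_number F i u =
     card {(j, v). v \<in> leaves (F j) \<and> (j < i \<or> j = i \<and> (v, u) \<in> lexord {(False, True)})}"

definition forest_mult :: "forest \<Rightarrow> forest \<Rightarrow> forest" where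
  "forest_mult F G =
     (\<lambda>i. F i \<union> (\<Union>v\<in>leaves (F i). {v @ u |u. u \<in> G (leaf_number F i v)}))"

definition forest_one :: forest where
  "forest_one = (\<lambda>i. {[]})"

definition Forests :: "forest monoid" where
  "Forests = \<lparr>carrier = {F. is_forest F}, mult = forest_mult, one = forest_one\<rparr>"

text \<open>The generator \<open>\<lambda>\<^sub>i\<close>.\<close>

definition caret :: "nat \<Rightarrow> forest" where
  "caret i = forest_one(i := {[], [False], [True]})"

definition forest_length :: "forest \<Rightarrow> nat" where
  "forest_length F =
     (THE n. \<exists>is. length is = n \<and> F = foldr forest_mult (map caret is) forest_one)"


section \<open>The groups \<open>S\<^sub>\<infinity>\<close> and \<open>B\<^sub>\<infinity>\<close>\<close>

definition S_inf :: "(nat \<Rightarrow> nat) monoid" where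
  "S_inf = \<lparr>carrier = {p. bij p \<and> finite {i. p i \<noteq> i}}, mult = (\<circ>), one = id\<rparr>"

definition perm_gen :: "nat \<Rightarrow> nat \<Rightarrow> nat" where
  "perm_gen m = Transposition.transpose m (Suc m)"

text \<open>The letter \<open>(m, True)\<close> stands for \<open>\<sigma>\<^sub>m\<close> and \<open>(m, False)\<close> for its inverse; \<open>braid_eq\<close> is the
  congruence on words whose quotient is the group with the given presentation.\<close>

inductive braid_eq :: "(nat \<times> bool) list \<Rightarrow> (nat \<times> bool) list \<Rightarrow> bool" where
  refl: "braid_eq u u"
| sym: "braid_eq u v \<Longrightarrow> braid_eq v u"
| trans: "braid_eq u v \<Longrightarrow> braid_eq v w \<Longrightarrow> braid_eq u w"
| cong: "braid_eq u u' \<Longrightarrow> braid_eq v v' \<Longrightarrow> braid_eq (u @ v) (u' @ v')"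
| cancel: "braid_eq [(m, b), (m, \<not> b)] []"
| commute: "\<bar>int m - int n\<bar> \<ge> 2 \<Longrightarrow>
    braid_eq [(m, True), (n, True)] [(n, True), (m, True)]"
| braid: "braid_eq [(m, True), (Suc m, True), (m, True)] [(Suc m, True), (m, True), (Suc m, True)]"

quotient_type braid = "(nat \<times> bool) list" / braid_eq
  by (intro equivpI reflpI sympI transpI)
     (blast intro: braid_eq.refl braid_eq.sym braid_eq.trans)+

lift_definition braid_mult :: "braid \<Rightarrow> braid \<Rightarrow> braid" is "(@)"
  by (rule braid_eq.cong)

lift_definition braid_one :: braid is "[]" .

lift_definition braid_gen :: "nat \<Rightarrow> braid" is "\<lambda>m. [(m, True)]" .

definition B_inf :: "braid monoid" where
  "B_inf = \<lparr>carrier = UNIV, mult = braid_mult, one = braid_one\<rparr>"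


section \<open>Zappa--Szep products\<close>

text \<open>\<open>act \<alpha> u\<close> is \<open>\<alpha> \<cdot> u\<close> and \<open>res \<alpha> u\<close> is \<open>\<alpha>\<^sup>u\<close>; \<open>\<sigma>\<close> lists the standard generators of \<open>A\<close>. These
  properties determine both functions on the carriers; nothing is required of
  them elsewhere.\<close>

locale zappa_szep =
  fixes A :: "('a, 'm) monoid_scheme"
    and \<sigma> :: "nat \<Rightarrow> 'a"
    and act :: "'a \<Rightarrow> forest \<Rightarrow> forest"
    and res :: "'a \<Rightarrow> forest \<Rightarrow> 'a"
  assumes act_closed: "\<lbrakk>\<alpha> \<in> carrier A; u \<in> carrier Forests\<rbrakk> \<Longrightarrow> act \<alpha> u \<in> carrier Forests"
    and res_closed: "\<lbrakk>\<alpha> \<in> carrier A; u \<in> carrier Forests\<rbrakk> \<Longrightarrow> res \<alpha> u \<in> carrier A"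
    and mult_act: "\<lbrakk>\<alpha> \<in> carrier A; \<beta> \<in> carrier A; u \<in> carrier Forests\<rbrakk> \<Longrightarrow>
      act (\<alpha> \<otimes>\<^bsub>A\<^esub> \<beta>) u = act \<alpha> (act \<beta> u)"
    and mult_res: "\<lbrakk>\<alpha> \<in> carrier A; \<beta> \<in> carrier A; u \<in> carrier Forests\<rbrakk> \<Longrightarrow>
      res (\<alpha> \<otimes>\<^bsub>A\<^esub> \<beta>) u = res \<alpha> (act \<beta> u) \<otimes>\<^bsub>A\<^esub> res \<beta> u"
    and act_mult: "\<lbrakk>\<alpha> \<in> carrier A; u \<in> carrier Forests; v \<in> carrier Forests\<rbrakk> \<Longrightarrow>
      act \<alpha> (u \<otimes>\<^bsub>Forests\<^esub> v) = act \<alpha> u \<otimes>\<^bsub>Forests\<^esub> act (res \<alpha> u) v"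
    and res_mult: "\<lbrakk>\<alpha> \<in> carrier A; u \<in> carrier Forests; v \<in> carrier Forests\<rbrakk> \<Longrightarrow>
      res \<alpha> (u \<otimes>\<^bsub>Forests\<^esub> v) = res (res \<alpha> u) v"
    and act_one: "\<alpha> \<in> carrier A \<Longrightarrow> act \<alpha> \<one>\<^bsub>Forests\<^esub> = \<one>\<^bsub>Forests\<^esub>"
    and res_one: "\<alpha> \<in> carrier A \<Longrightarrow> res \<alpha> \<one>\<^bsub>Forests\<^esub> = \<alpha>"
    and one_act: "u \<in> carrier Forests \<Longrightarrow> act \<one>\<^bsub>A\<^esub> u = u"
    and one_res: "u \<in> carrier Forests \<Longrightarrow> res \<one>\<^bsub>A\<^esub> u = \<one>\<^bsub>A\<^esub>"
    and act_gen: "\<epsilon> \<in> {1, -1} \<Longrightarrow>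
      act (\<sigma> q [^]\<^bsub>A\<^esub> (\<epsilon> :: int)) (caret m) = caret (perm_gen q m)"
    and res_gen: "\<epsilon> \<in> {1, -1} \<Longrightarrow>
      res (\<sigma> q [^]\<^bsub>A\<^esub> (\<epsilon> :: int)) (caret m) =
        (if m < q then \<sigma> (q + 1) [^]\<^bsub>A\<^esub> \<epsilon>
         else if m = q then \<sigma> q [^]\<^bsub>A\<^esub> \<epsilon> \<otimes>\<^bsub>A\<^esub> \<sigma> (q + 1) [^]\<^bsub>A\<^esub> \<epsilon>
         else if m = q + 1 then \<sigma> (q + 1) [^]\<^bsub>A\<^esub> \<epsilon> \<otimes>\<^bsub>A\<^esub> \<sigma> q [^]\<^bsub>A\<^esub> \<epsilon>
         else \<sigma> q [^]\<^bsub>A\<^esub> \<epsilon>)"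

definition zs_product ::
  "('a, 'm) monoid_scheme \<Rightarrow> ('a \<Rightarrow> forest \<Rightarrow> forest) \<Rightarrow> ('a \<Rightarrow> forest \<Rightarrow> 'a) \<Rightarrow>
    (forest \<times> 'a) monoid" where
  "zs_product A act res =
     \<lparr>carrier = carrier Forests \<times> carrier A,
      mult = (\<lambda>(u, \<alpha>) (v, \<beta>). (u \<otimes>\<^bsub>Forests\<^esub> act \<alpha> v, res \<alpha> v \<otimes>\<^bsub>A\<^esub> \<beta>)),
      one = (\<one>\<^bsub>Forests\<^esub>, \<one>\<^bsub>A\<^esub>)\<rparr>"


section \<open>Groups of right fractions\<close>

definition fraction :: "('g, 'n) monoid_scheme \<Rightarrow> ('m \<Rightarrow> 'g) \<Rightarrow> 'm \<Rightarrow> 'm \<Rightarrow> 'g" where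
  "fraction Q \<iota> u v = \<iota> u \<otimes>\<^bsub>Q\<^esub> inv\<^bsub>Q\<^esub> \<iota> v"

text \<open>\<open>Q\<close>, with \<open>M\<close> embedded by \<open>\<iota>\<close>, is a group of right fractions of \<open>M\<close>. (A multiplicative map
  into a group preserves the identity.)\<close>

definition group_of_right_fractions ::
  "('m, 'k) monoid_scheme \<Rightarrow> ('g, 'n) monoid_scheme \<Rightarrow> ('m \<Rightarrow> 'g) \<Rightarrow> bool" where
  "group_of_right_fractions M Q \<iota> \<longleftrightarrow>
     group Q \<and> \<iota> \<in> hom M Q \<and> inj_on \<iota> (carrier M) \<and>
     (\<forall>x\<in>carrier Q. \<exists>u\<in>carrier M. \<exists>v\<in>carrier M. x = fraction Q \<iota> u v)"

definition representing_triple ::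
  "('a, 'm) monoid_scheme \<Rightarrow> ('g, 'n) monoid_scheme \<Rightarrow> (forest \<times> 'a \<Rightarrow> 'g) \<Rightarrow> 'g \<Rightarrow>
    forest \<Rightarrow> 'a \<Rightarrow> forest \<Rightarrow> bool" where
  "representing_triple A Q \<iota> x G \<alpha> H \<longleftrightarrow>
     G \<in> carrier Forests \<and> H \<in> carrier Forests \<and> \<alpha> \<in> carrier A \<and>
     x = fraction Q \<iota> (G, \<alpha>) (H, \<one>\<^bsub>A\<^esub>)"

definition minimal_triple ::
  "('a, 'm) monoid_scheme \<Rightarrow> ('g, 'n) monoid_scheme \<Rightarrow> (forest \<times> 'a \<Rightarrow> 'g) \<Rightarrow> 'g \<Rightarrow>
    forest \<Rightarrow> 'a \<Rightarrow> forest \<Rightarrow> bool" where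
  "minimal_triple A Q \<iota> x G \<alpha> H \<longleftrightarrow>
     representing_triple A Q \<iota> x G \<alpha> H \<and>
     (\<forall>G' \<alpha>' H'. representing_triple A Q \<iota> x G' \<alpha>' H' \<longrightarrow> forest_length G \<le> forest_length G')"

end

theory Submission
  imports Defs "HOL-Algebra.Generated_Groups"
begin

text \<open>Write \<open>A\<close> for either of the two groups and \<open>M\<close> for the product of the forests with \<open>A\<close>. Every
  fraction can be given a forest \<open>H\<close> as denominator, because the \<open>A\<close>-part of a denominator is
  invertible in \<open>M\<close>. A fraction of \<open>p \<in> M\<close> by \<open>H\<close> does not change when a common right factor
  \<open>\<lambda>\<^sub>i\<close> of \<open>p\<close> and \<open>H\<close> is cancelled, and cancelling shortens the forest in the numerator. The theorem
  says that a pair \<open>(p, H)\<close> without common right factor \<open>\<lambda>\<^sub>i\<close> (a reduced pair) divides every other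
  representative of the same fraction: then it is the shortest one and the only one that is reduced.

  Two representatives with forests as denominators have a common multiple, so it is enough to know
  that cancelling carets is confluent: if two pairs yield the same pair when multiplied by
  \<open>\<lambda>\<^sub>i\<close> and \<open>\<lambda>\<^sub>j\<close>, \<open>i < j\<close>, then they arise from one pair by multiplication with carets
  (\<open>mult_caret_diamond_M\<close>). The usual argument by induction on the length then applies
  (\<open>reduced_divides\<close>).

  For forests alone, confluence is a matter of looking at leaves (\<open>mult_caret_diamond\<close>): multiplying
  by a caret splits one leaf into two, a caret whose two tips are leaves can be cut off again, and two
  different such carets do not interfere. For \<open>M\<close> the question becomes when
  \<open>\<alpha>\<^bsup>\<lambda>\<^sub>i\<^esup> = \<beta>\<^bsup>\<lambda>\<^sub>j\<^esup>\<close> in \<open>A\<close>. Geometrically \<open>\<alpha>\<^bsup>\<lambda>\<^sub>i\<^esup>\<close> doubles the strand of \<open>\<alpha>\<close> that starts at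
  \<open>i\<close>; an element in which two different pairs of strands run in parallel comes from one
  element \<open>\<gamma>\<close> by two doublings (\<open>dbl_eq_dbl\<close>), and \<open>\<gamma>\<close> is found by deleting a strand. Deletion of
  strands makes sense for permutations and for braids; the locale \<open>strand_group\<close> states its
  properties and makes one proof serve both groups.

  The group of fractions supplies further algebra. Since \<open>M\<close> embeds in a group, \<open>M\<close> and the
  forests inside it are associative and cancellative, and since every element of the group is a
  fraction, common right multiples exist.\<close>

section \<open>Leaves of a forest from left to right\<close>

text \<open>The order compares all nodes, a node preceding its descendants; thus it is total without reference
  to a forest. Among the leaves of one forest only the order from left to right remains.\<close>

definition left_of :: "(nat \<times> bool list) rel" where
  "left_of = less_than <*lex*> lexord {(False, True)}"

definition forest_leaves :: "forest \<Rightarrow> (nat \<times> bool list) set" where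
  "forest_leaves F = {(i, u). u \<in> leaves (F i)}"

lemma leaf_number_eq_card:
  "leaf_number F i u = card {x \<in> forest_leaves F. (x, (i, u)) \<in> left_of}"
  unfolding leaf_number_def forest_leaves_def left_of_def
  by (rule arg_cong[where f = card]) auto

lemma
  assumes "is_tree T"
  shows is_tree_finite: "finite T" and is_tree_Nil: "[] \<in> T"
    and is_tree_prefix: "u @ v \<in> T \<Longrightarrow> u \<in> T"
    and is_tree_sibling: "u @ [b] \<in> T \<Longrightarrow> u @ [c] \<in> T"
  using assms unfolding is_tree_def
  by (auto, metis append_Nil ex_in_conv, (metis (full_types))+)

lemma is_forest_tree: "is_forest F \<Longrightarrow> is_tree (F i)"
  by (simp add: is_forest_def)

lemma leaf_maximal:
  assumes "is_tree T" "u \<in> leaves T" "u @ v \<in> T"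
  shows "v = []"
proof (cases v)
  case (Cons b w)
  then have "u @ [b] \<in> T" using is_tree_prefix[OF assms(1), of "u @ [b]" w] assms(3) by simp
  then show ?thesis using assms(2) by (cases b) (auto simp: leaves_def)
qed simp

lemma irrefl_left_of: "irrefl left_of"
  and trans_left_of: "trans left_of"
  and total_left_of: "total left_of"
proof -
  let ?R = "{(False, True)}"
  have "irrefl (lexord ?R)" by (rule irreflI, rule lexord_irreflexive) simp
  then show "irrefl left_of"
    unfolding left_of_def by (intro irrefl_lex_prod) (auto intro: irreflI)
  have "trans ?R" by (rule transI) simp
  then show "trans left_of"
    unfolding left_of_def by (intro trans_lex_prod lexord_transI) auto
  have "total ?R" by (rule total_onI) auto
  then show "total left_of"
    unfolding left_of_def by (intro total_lex_prod total_lexord) auto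
qed

lemma finite_leaves_left_of:
  assumes "is_forest F"
  shows "finite {x \<in> forest_leaves F. (x, y) \<in> left_of}"
proof (rule finite_subset)
  show "{x \<in> forest_leaves F. (x, y) \<in> left_of} \<subseteq> (SIGMA i:{..fst y}. F i)"
    by (cases y) (auto simp: forest_leaves_def left_of_def leaves_def)
  show "finite (SIGMA i:{..fst y}. F i)"
    using is_tree_finite[OF is_forest_tree[OF assms]] by auto
qed

lemma leaf_number_mono:
  assumes "is_forest F" "(i, u) \<in> forest_leaves F" "((i, u), (j, v)) \<in> left_of"
  shows "leaf_number F i u < leaf_number F j v"
  unfolding leaf_number_eq_card
proof (rule psubset_card_mono[OF finite_leaves_left_of[OF assms(1)]], rule psubsetI)
  show "{x \<in> forest_leaves F. (x, (i, u)) \<in> left_of} \<subseteq> {x \<in> forest_leaves F. (x, (j, v)) \<in> left_of}"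
    using assms(3) trans_left_of by (auto dest: transD)
  show "{x \<in> forest_leaves F. (x, (i, u)) \<in> left_of} \<noteq> {x \<in> forest_leaves F. (x, (j, v)) \<in> left_of}"
    using assms irrefl_left_of by (auto simp: irrefl_def)
qed

lemma inj_on_leaf_number:
  assumes "is_forest F"
  shows "inj_on (\<lambda>(i, u). leaf_number F i u) (forest_leaves F)"
proof (rule inj_onI)
  fix x y assume *: "x \<in> forest_leaves F" "y \<in> forest_leaves F"
    "(case x of (i, u) \<Rightarrow> leaf_number F i u) = (case y of (i, u) \<Rightarrow> leaf_number F i u)"
  obtain i u j v where "x = (i, u)" "y = (j, v)" by (cases x, cases y)
  then show "x = y"
    using * total_left_of leaf_number_mono[OF assms, of i u j v] leaf_number_mono[OF assms, of j v i u]
    by (auto simp: total_on_def)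
qed

lemma leaf_exists:
  assumes "is_tree T"
  shows "\<exists>u. u \<in> leaves T"
proof -
  have "Max (length ` T) \<in> length ` T"
    using is_tree_finite[OF assms] is_tree_Nil[OF assms] by (intro Max_in) auto
  then obtain u where u: "u \<in> T" "Max (length ` T) = length u" by blast
  have "length v \<le> length u" if "v \<in> T" for v
    using that is_tree_finite[OF assms] by (simp flip: u(2))
  from this[of "u @ [_]"] have "u \<in> leaves T" using u(1) by (auto simp: leaves_def)
  then show ?thesis ..
qed

text \<open>The leaves to the left of a given one are numbered injectively by smaller numbers, and there
  are as many of them as smaller numbers; so the numbers in use are closed downwards.\<close>

lemma leaf_number_surj:
  assumes F: "is_forest F"
  shows "\<exists>i u. u \<in> leaves (F i) \<and> leaf_number F i u = n"
proof -
  let ?n = "\<lambda>(i, u). leaf_number F i u" and ?L = "forest_leaves F"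
  have "infinite ?L"
  proof
    assume "finite ?L"
    moreover have "fst ` ?L = UNIV"
      using leaf_exists[OF is_forest_tree[OF F]] by (force simp: forest_leaves_def)
    ultimately show False using finite_imageI[of ?L fst] by simp
  qed
  then have "infinite (?n ` ?L)" using inj_on_leaf_number[OF F] by (simp add: finite_image_iff)
  then obtain m where m: "m \<in> ?n ` ?L" "n < m" 
    unfolding finite_nat_set_iff_bounded_le using not_le by blast
  then obtain i u where iu: "(i, u) \<in> ?L" "leaf_number F i u = m" by auto
  let ?S = "{x \<in> ?L. (x, (i, u)) \<in> left_of}"
  have "?n ` ?S \<subseteq> {..<m}" using leaf_number_mono[OF F] iu(2) by fastforce
  moreover have "card (?n ` ?S) = card {..<m}"
    using iu(2) card_image[OF inj_on_subset[OF inj_on_leaf_number[OF F], of ?S]]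
    by (simp add: leaf_number_eq_card)
  ultimately have "?n ` ?S = {..<m}" by (simp add: card_subset_eq)
  then have "n \<in> ?n ` ?S" using m(2) by simp
  then show ?thesis by (auto simp: forest_leaves_def)
qed

section \<open>Products of forests\<close>

lemma is_tree_graft:
  assumes T: "is_tree T" and G: "\<And>v. is_tree (G v)"
  shows "is_tree (T \<union> (\<Union>v\<in>leaves T. {v @ u |u. u \<in> G v}))" (is "is_tree ?P")
  unfolding is_tree_def
proof (intro conjI allI impI)
  have "{v @ u |u. u \<in> G v} = (@) v ` G v" for v by blast
  then have "?P = T \<union> (\<Union>v\<in>leaves T. (@) v ` G v)" by simp
  moreover have "finite (leaves T)" using is_tree_finite[OF T] by (simp add: leaves_def)
  ultimately show "finite ?P" using is_tree_finite[OF T] is_tree_finite[OF G] by simp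
  show "?P \<noteq> {}" using is_tree_Nil[OF T] by blast
  show "u \<in> ?P" if prem: "u @ w \<in> ?P" for u w
  proof (cases "u @ w \<in> T")
    case True then show ?thesis using is_tree_prefix[OF T] by blast
  next
    case False
    then obtain v x where v: "v \<in> leaves T" "x \<in> G v" "u @ w = v @ x" using prem by auto
    then obtain y where "u @ y = v \<or> u = v @ y \<and> x = y @ w"
      by (auto simp: append_eq_append_conv2)
    then show ?thesis
    proof
      assume "u @ y = v"
      then show ?thesis using v(1) is_tree_prefix[OF T, of u y] by (auto simp: leaves_def)
    next
      assume "u = v @ y \<and> x = y @ w"
      then show ?thesis using v is_tree_prefix[OF G, of y w] by auto
    qed
  qed
  have "u @ [c] \<in> ?P" if prem: "u @ [b] \<in> ?P" for u b c
  proof (cases "u @ [b] \<in> T")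
    case True then show ?thesis using is_tree_sibling[OF T] by blast
  next
    case False
    then obtain v x where v: "v \<in> leaves T" "x \<in> G v" "u @ [b] = v @ x" using prem by auto
    show ?thesis
    proof (cases x rule: rev_cases)
      case Nil
      then show ?thesis using False v by (auto simp: leaves_def)
    next
      case (snoc y b')
      then have "y @ [c] \<in> G v" "u = v @ y" using v is_tree_sibling[OF G] by auto
      then show ?thesis using v(1) by auto
    qed
  qed
  then show "u @ [False] \<in> ?P \<longleftrightarrow> u @ [True] \<in> ?P" for u by blast
qed

text \<open>Only the finite support needs care: a trivial tree of \<open>F\<close> becomes non-trivial only if its leaf
  carries a non-trivial tree of \<open>G\<close>, and different leaves carry different trees.\<close>

lemma is_forest_mult:
  assumes F: "is_forest F" and G: "is_forest G"
  shows "is_forest (forest_mult F G)"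
  unfolding is_forest_def
proof (intro conjI allI)
  show "is_tree (forest_mult F G i)" for i
    unfolding forest_mult_def
    by (rule is_tree_graft) (use F G in \<open>simp_all add: is_forest_tree\<close>)
  let ?S = "{i. F i = {[]} \<and> G (leaf_number F i []) \<noteq> {[]}}"
  have "forest_mult F G i = {[]}" if "F i = {[]}" "G (leaf_number F i []) = {[]}" for i
    using that by (simp add: forest_mult_def leaves_def)
  then have "{i. forest_mult F G i \<noteq> {[]}} \<subseteq> {i. F i \<noteq> {[]}} \<union> ?S" by blast
  moreover have "finite ?S"
  proof (rule inj_on_finite)
    show "inj_on (\<lambda>i. leaf_number F i []) ?S"
    proof (rule inj_onI)
      fix i j assume ij: "i \<in> ?S" "j \<in> ?S" "leaf_number F i [] = leaf_number F j []"
      then have "(i, []) \<in> forest_leaves F" "(j, []) \<in> forest_leaves F"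
        by (simp_all add: forest_leaves_def leaves_def)
      then show "i = j" using inj_onD[OF inj_on_leaf_number[OF F], of "(i, [])" "(j, [])"] ij(3) by simp
    qed
    show "(\<lambda>i. leaf_number F i []) ` ?S \<subseteq> {k. G k \<noteq> {[]}}" by auto
    show "finite {k. G k \<noteq> {[]}}" using G by (simp add: is_forest_def)
  qed
  ultimately show "finite {i. forest_mult F G i \<noteq> {[]}}"
    using F by (elim finite_subset) (simp add: is_forest_def)
qed

lemma is_forest_one: "is_forest forest_one"
  by (simp add: is_forest_def forest_one_def is_tree_def)

lemma is_forest_caret: "is_forest (caret n)"
proof -
  have "u \<in> {[], [False], [True]}" if "u @ v \<in> {[], [False], [True]}" for u v
    using that by (cases u) auto
  then have "is_tree {[], [False], [True]}" unfolding is_tree_def by simp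
  moreover have "{i. caret n i \<noteq> {[]}} \<subseteq> {n}" by (auto simp: caret_def forest_one_def)
  moreover have "is_tree (forest_one i)" for i
    using is_forest_one by (rule is_forest_tree)
  ultimately show ?thesis
    unfolding is_forest_def by (simp add: caret_def finite_subset)
qed

text \<open>Splitting a leaf and cutting a caret are right multiplication by a caret and its inverse, freed from
  the numbering of leaves; in this form operations at different places visibly commute.\<close>

definition split_leaf :: "forest \<Rightarrow> nat \<Rightarrow> bool list \<Rightarrow> forest" where
  "split_leaf F i v = F(i := F i \<union> {v @ [False], v @ [True]})"

definition cut_caret :: "forest \<Rightarrow> nat \<Rightarrow> bool list \<Rightarrow> forest" where
  "cut_caret F i v = F(i := F i - {v @ [False], v @ [True]})"

lemma mult_caret:
  assumes F: "is_forest F" and v: "v \<in> leaves (F i)"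
  shows "forest_mult F (caret (leaf_number F i v)) = split_leaf F i v"
proof
  fix j
  have eq: "leaf_number F j w = leaf_number F i v \<longleftrightarrow> j = i \<and> w = v" if "w \<in> leaves (F j)" for w
    using inj_onD[OF inj_on_leaf_number[OF F], of "(j, w)" "(i, v)"] that v
    by (auto simp: forest_leaves_def)
  have "(\<Union>w\<in>leaves (F j). {w @ u |u. u \<in> caret (leaf_number F i v) (leaf_number F j w)})
    = (\<Union>w\<in>leaves (F j). if j = i \<and> w = v then {w, w @ [False], w @ [True]} else {w})"
    by (rule SUP_cong[OF HOL.refl]) (auto simp: eq caret_def forest_one_def)
  then show "forest_mult F (caret (leaf_number F i v)) j = split_leaf F i v j"
    using v by (auto simp: forest_mult_def split_leaf_def leaves_def split: if_splits)
qed

lemma cut_caret: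
  assumes F: "is_forest F" and v: "v @ [False] \<in> leaves (F i)" "v @ [True] \<in> leaves (F i)"
  shows is_forest_cut_caret: "is_forest (cut_caret F i v)"
    and leaf_cut_caret: "v \<in> leaves (cut_caret F i v i)"
    and split_cut_caret: "split_leaf (cut_caret F i v) i v = F"
proof -
  note T = is_forest_tree[OF F, of i]
  let ?T = "F i - {v @ [False], v @ [True]}"
  have in_T: "v @ [b] \<in> F i" for b using v by (cases b) (auto simp: leaves_def)
  have v_in: "v \<in> F i" using is_tree_prefix[OF T in_T] .
  have max: "w = []" if "v @ b # w \<in> F i" for b w
    using leaf_maximal[OF T, of "v @ [b]" w] that v by (cases b) auto
  have tree: "is_tree ?T"
    unfolding is_tree_def
  proof (intro conjI allI impI)
    show "finite ?T" using is_tree_finite[OF T] by simp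
    show "?T \<noteq> {}" using v_in by auto
    show "u \<in> ?T" if "u @ w \<in> ?T" for u w
      using that is_tree_prefix[OF T, of u w] max[of _ w] by (cases "w = []") auto
    show "u @ [False] \<in> ?T \<longleftrightarrow> u @ [True] \<in> ?T" for u
      using is_tree_sibling[OF T] by auto
  qed
  have "finite {j. cut_caret F i v j \<noteq> {[]}}"
  proof (rule finite_subset)
    show "{j. cut_caret F i v j \<noteq> {[]}} \<subseteq> insert i {j. F j \<noteq> {[]}}"
      by (auto simp: cut_caret_def)
    show "finite (insert i {j. F j \<noteq> {[]}})" using F by (simp add: is_forest_def)
  qed
  moreover have "is_tree (cut_caret F i v j)" for j
    using is_forest_tree[OF F] tree by (simp add: cut_caret_def)
  ultimately show "is_forest (cut_caret F i v)" by (simp add: is_forest_def)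
  show "v \<in> leaves (cut_caret F i v i)" using v_in by (auto simp: leaves_def cut_caret_def)
  show "split_leaf (cut_caret F i v) i v = F"
    using in_T by (auto simp: split_leaf_def cut_caret_def fun_eq_iff)
qed

lemma cut_split_leaf:
  assumes "v \<in> leaves (F i)"
  shows "cut_caret (split_leaf F i v) i v = F"
  using assms by (auto simp: split_leaf_def cut_caret_def leaves_def fun_eq_iff)

lemma leaves_split_leaf:
  assumes F: "is_forest F" and v: "v \<in> leaves (F i)"
  shows "forest_leaves (split_leaf F i v)
    = forest_leaves F - {(i, v)} \<union> {(i, v @ [False]), (i, v @ [True])}"
proof -
  note T = is_forest_tree[OF F, of i]
  have max: "w = []" if "v @ w \<in> F i" for w using leaf_maximal[OF T v that] .
  have "leaves (F i \<union> {v @ [False], v @ [True]}) = leaves (F i) - {v} \<union> {v @ [False], v @ [True]}"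
    using v max by (fastforce simp: leaves_def)
  then have "leaves (split_leaf F i v j) = (if j = i then leaves (F i) - {v} \<union> {v @ [False], v @ [True]}
      else leaves (F j))" for j
    by (simp add: split_leaf_def)
  then have "(j, w) \<in> forest_leaves (split_leaf F i v) \<longleftrightarrow>
      (j, w) \<in> forest_leaves F - {(i, v)} \<union> {(i, v @ [False]), (i, v @ [True])}" for j w
    by (cases "j = i") (simp_all add: forest_leaves_def)
  then show ?thesis by (intro subset_antisym subrelI) blast+
qed

section \<open>Forests with two removable carets\<close>

lemma lexord_append_left_iff:
  assumes "\<And>z. w \<noteq> v @ z" "\<And>z. v \<noteq> w @ z"
  shows "(v @ a, w) \<in> lexord r \<longleftrightarrow> (v, w) \<in> lexord r"
  using assms
proof (induction v arbitrary: w)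
  case (Cons x v)
  then show ?case by (cases w) auto
qed auto

text \<open>The two new leaves lie to the left of another leaf exactly if the leaf that they replace did.\<close>

lemma leaf_number_split_leaf:
  assumes F: "is_forest F" and v: "v \<in> leaves (F i)" and w: "w \<in> leaves (F j)"
    and ne: "(j, w) \<noteq> (i, v)"
  shows "leaf_number (split_leaf F i v) j w
    = leaf_number F j w + (if ((i, v), (j, w)) \<in> left_of then 1 else 0)"
proof -
  let ?x = "(i, v)" and ?y = "(j, w)"
  \<comment> \<open>Distinct leaves are not prefixes of one another, so the comparison is decided before \<open>v\<close> ends.\<close>
  have child: "((i, v @ [b]), ?y) \<in> left_of \<longleftrightarrow> (?x, ?y) \<in> left_of" for b
  proof (cases "i = j")
    case True
    note max = leaf_maximal[OF is_forest_tree[OF F]]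
    have "(v @ [b], w) \<in> lexord {(False, True)} \<longleftrightarrow> (v, w) \<in> lexord {(False, True)}"
    proof (rule lexord_append_left_iff)
      show "w \<noteq> v @ z" for z using max[OF v, of z] w ne True by (auto simp: leaves_def)
      show "v \<noteq> w @ z" for z using max[OF w, of z] v ne True by (auto simp: leaves_def)
    qed
    then show ?thesis using True by (simp add: left_of_def)
  qed (simp add: left_of_def)
  let ?S = "{z \<in> forest_leaves F. (z, ?y) \<in> left_of}"
  let ?S' = "{z \<in> forest_leaves (split_leaf F i v). (z, ?y) \<in> left_of}"
  have fin: "finite ?S" by (rule finite_leaves_left_of[OF F])
  have x: "?x \<in> forest_leaves F" using v by (simp add: forest_leaves_def)
  have new: "(i, v @ [b]) \<notin> forest_leaves F" for b
    using v by (cases b) (auto simp: forest_leaves_def leaves_def)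
  show ?thesis
  proof (cases "(?x, ?y) \<in> left_of")
    case True
    then have "?S' = (?S - {?x}) \<union> {(i, v @ [False]), (i, v @ [True])}"
      using leaves_split_leaf[OF F v] child by blast
    then have "?S' = insert (i, v @ [False]) (insert (i, v @ [True]) (?S - {?x}))" by auto
    then have "card ?S' = card (?S - {?x}) + 2"
      using fin new by simp
    moreover have "card ?S = Suc (card (?S - {?x}))"
      using card.remove[OF fin, of ?x] x True by blast
    ultimately show ?thesis using True by (simp add: leaf_number_eq_card)
  next
    case False
    then have "?S' = ?S" using leaves_split_leaf[OF F v] child by auto
    then show ?thesis using False by (simp add: leaf_number_eq_card)
  qed
qed

text \<open>The common product has a caret with leaves \<open>i\<close> and \<open>i + 1\<close> and another one with leaves \<open>j\<close> and
  \<open>j + 1\<close>. They are disjoint, which forces \<open>i + 2 \<le> j\<close>, and \<open>E\<close> is what is left when both are cut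
  off. The index \<open>j - 1\<close> arises because in \<open>E\<close> the first caret is shrunk to one leaf.\<close>

lemma mult_caret_diamond:
  assumes F: "is_forest F" and G: "is_forest G"
    and eq: "forest_mult F (caret i) = forest_mult G (caret j)" and less: "i < j"
  shows "\<exists>E. is_forest E \<and> F = forest_mult E (caret (j - 1)) \<and> G = forest_mult E (caret i) \<and> i + 2 \<le> j"
proof -
  obtain s v where v: "v \<in> leaves (F s)" "leaf_number F s v = i"
    using leaf_number_surj[OF F] by blast
  obtain t w where w: "w \<in> leaves (G t)" "leaf_number G t w = j"
    using leaf_number_surj[OF G] by blast
  define P where "P = forest_mult F (caret i)"
  have P: "P = split_leaf F s v" "P = split_leaf G t w"
    using mult_caret[OF F v(1)] mult_caret[OF G w(1)] eq v(2) w(2) by (simp_all add: P_def)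
  have FP: "F = cut_caret P s v" and GP: "G = cut_caret P t w"
    using P cut_split_leaf v w by metis+
  have ne: "(s, v) \<noteq> (t, w)" using FP GP v w less by auto
  have leaf: "(t, w @ [b]) \<in> forest_leaves P" for b
    using leaves_split_leaf[OF G w(1)] P(2) by (cases b) auto
  have "(t, w @ [b]) \<in> forest_leaves F" for b
    using leaf[of b] ne leaves_split_leaf[OF F v(1)] P(1) by auto
  then have wF: "w @ [False] \<in> leaves (F t)" "w @ [True] \<in> leaves (F t)"
    by (auto simp: forest_leaves_def)
  \<comment> \<open>Splitting the leaf \<open>(s, v)\<close> leaves the caret at \<open>(t, w)\<close> untouched, so it can be cut from \<open>F\<close> too.\<close>
  define E where "E = cut_caret F t w"
  have E: "is_forest E" "w \<in> leaves (E t)" "F = split_leaf E t w"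
    using cut_caret[OF F wF] by (simp_all add: E_def)
  have "v \<in> leaves (E s)"
  proof -
    have "v \<noteq> w @ [b]" if "s = t" for b
    proof
      assume "v = w @ [b]"
      then have "v \<in> leaves (P s)" using leaf[of b] that by (simp add: forest_leaves_def)
      then show False using P(1) by (simp add: leaves_def split_leaf_def)
    qed
    then show ?thesis using v(1) by (cases "s = t") (simp_all add: E_def cut_caret_def leaves_def)
  qed
  moreover have "G = split_leaf E s v"
  proof
    fix k
    define V W where "V = {v @ [False], v @ [True]}" and "W = {w @ [False], w @ [True]}"
    have "V \<subseteq> P s" using P(1) by (simp add: split_leaf_def V_def)
    moreover have "V \<inter> W = {}" if "s = t" using ne that by (simp add: V_def W_def)
    moreover have "G k = (if k = t then P k - W else P k)"
      by (simp add: GP cut_caret_def W_def)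
    moreover have "split_leaf E s v k =
        (let B = if k = s then P k - V else P k; C = if k = t then B - W else B
         in if k = s then C \<union> V else C)"
      by (simp add: E_def FP cut_caret_def split_leaf_def V_def W_def)
    ultimately show "G k = split_leaf E s v k"
      by (cases "k = s"; cases "k = t") (simp_all add: Let_def, blast+)
  qed
  ultimately have v': "v \<in> leaves (E s)" "G = split_leaf E s v" .
  let ?a = "leaf_number E s v" and ?b = "leaf_number E t w"
  have eqs: "F = forest_mult E (caret ?b)" "G = forest_mult E (caret ?a)"
    using mult_caret[OF E(1,2)] mult_caret[OF E(1) v'(1)] E(3) v'(2) by simp_all
  have i: "i = ?a + (if ((t, w), (s, v)) \<in> left_of then 1 else 0)"
    using leaf_number_split_leaf[OF E(1,2) v'(1) ne] v(2) E(3) by simp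
  have j: "j = ?b + (if ((s, v), (t, w)) \<in> left_of then 1 else 0)"
    using leaf_number_split_leaf[OF E(1) v'(1) E(2) ne[symmetric]] w(2) v'(2) by simp
  have leaves: "(s, v) \<in> forest_leaves E" "(t, w) \<in> forest_leaves E"
    using E(2) v'(1) by (simp_all add: forest_leaves_def)
  have not_both: "\<not> (((s, v), (t, w)) \<in> left_of \<and> ((t, w), (s, v)) \<in> left_of)"
    using transD[OF trans_left_of] irrefl_left_of by (metis irrefl_def)
  show ?thesis
  proof (cases "((s, v), (t, w)) \<in> left_of")
    case True
    then have "i = ?a" "j = ?b + 1" "?a < ?b"
      using i j not_both leaf_number_mono[OF E(1) leaves(1) True] by simp_all
    then show ?thesis using E(1) eqs by auto
  next
    case False
    then have True': "((t, w), (s, v)) \<in> left_of"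
      using ne total_left_of by (auto simp: total_on_def)
    then have "i = ?a + 1" "j = ?b" "?b < ?a"
      using i j False leaf_number_mono[OF E(1) leaves(2) True'] by simp_all
    then show ?thesis using less by simp
  qed
qed

section \<open>Carets generate\<close>

text \<open>Each caret factor contributes one inner node, so counting them gives the length of a forest without
  choosing a factorization.\<close>

definition inner_nodes :: "forest \<Rightarrow> (nat \<times> bool list) set" where
  "inner_nodes F = {(i, u). u @ [False] \<in> F i}"

lemma finite_inner_nodes:
  assumes "is_forest F"
  shows "finite (inner_nodes F)"
proof (rule finite_subset)
  have nontrivial: "F i \<noteq> {[]}" if "u @ [False] \<in> F i" for i u
    using that by force
  have "u \<in> F i" if "u @ [False] \<in> F i" for u i
    using is_tree_prefix[OF is_forest_tree[OF assms]] that .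
  then show "inner_nodes F \<subseteq> (SIGMA i:{i. F i \<noteq> {[]}}. F i)"
    using nontrivial by (fastforce simp: inner_nodes_def)
  show "finite (SIGMA i:{i. F i \<noteq> {[]}}. F i)"
    using assms is_tree_finite by (intro finite_SigmaI) (auto simp: is_forest_def)
qed

lemma inner_nodes_one: "inner_nodes forest_one = {}"
  by (simp add: inner_nodes_def forest_one_def)

lemma inner_nodes_mult: "inner_nodes F \<subseteq> inner_nodes (forest_mult F G)"
  by (auto simp: inner_nodes_def forest_mult_def)

lemma inner_nodes_empty:
  assumes "is_forest F" "inner_nodes F = {}"
  shows "F = forest_one"
proof
  fix i
  have "u = []" if "u \<in> F i" for u
  proof (cases u rule: rev_cases)
    case (snoc w b)
    then have "w @ [False] \<in> F i"
      using is_tree_sibling[OF is_forest_tree[OF assms(1)]] that by blast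
    then show ?thesis using assms(2) by (auto simp: inner_nodes_def)
  qed simp
  then show "F i = forest_one i"
    using is_tree_Nil[OF is_forest_tree[OF assms(1), of i]] by (auto simp: forest_one_def)
qed

lemma card_inner_nodes_caret:
  assumes F: "is_forest F"
  shows "card (inner_nodes (forest_mult F (caret n))) = Suc (card (inner_nodes F))"
proof -
  obtain i v where v: "v \<in> leaves (F i)" "leaf_number F i v = n" using leaf_number_surj[OF F] by blast
  have "w = v" if "w @ [False] = v @ [True] \<or> w @ [False] = v @ [False]" for w using that by auto
  then have "inner_nodes (split_leaf F i v) = insert (i, v) (inner_nodes F)"
    by (auto simp: inner_nodes_def split_leaf_def split: if_splits)
  moreover have "(i, v) \<notin> inner_nodes F" using v(1) by (simp add: inner_nodes_def leaves_def)
  ultimately show ?thesis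
    using mult_caret[OF F v(1)] v(2) finite_inner_nodes[OF F] by simp
qed

text \<open>Both children of an inner node of maximal depth are leaves.\<close>

lemma forest_last_caret:
  assumes F: "is_forest F" and ne: "F \<noteq> forest_one"
  shows "\<exists>E n. is_forest E \<and> F = forest_mult E (caret n)"
proof -
  let ?d = "\<lambda>x. length (snd x)"
  have "inner_nodes F \<noteq> {}" using inner_nodes_empty[OF F] ne by blast
  then have "Max (?d ` inner_nodes F) \<in> ?d ` inner_nodes F"
    using finite_inner_nodes[OF F] by (intro Max_in) auto
  then obtain y where y: "y \<in> inner_nodes F" "Max (?d ` inner_nodes F) = ?d y" by blast
  have y_max: "?d x \<le> ?d y" if "x \<in> inner_nodes F" for x
    using that finite_inner_nodes[OF F] by (simp flip: y(2))
  obtain i v where iv: "y = (i, v)" by (cases y)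
  have in_F: "v @ [b] \<in> F i" for b
    using y(1) is_tree_sibling[OF is_forest_tree[OF F]] by (auto simp: iv inner_nodes_def)
  have "(v @ [b]) @ [c] \<notin> F i" for b c
  proof
    assume "(v @ [b]) @ [c] \<in> F i"
    then have "(i, v @ [b]) \<in> inner_nodes F"
      using is_tree_sibling[OF is_forest_tree[OF F]] unfolding inner_nodes_def by blast
    then show False using y_max[of "(i, v @ [b])"] iv by simp
  qed
  then have leaf: "v @ [b] \<in> leaves (F i)" for b using in_F by (simp add: leaves_def)
  show ?thesis
    using cut_caret[OF F leaf leaf] mult_caret[of "cut_caret F i v" v i] by metis
qed

lemma forest_caret_induct [consumes 1, case_names one caret]:
  assumes "is_forest F" and "P forest_one"
    and "\<And>E n. is_forest E \<Longrightarrow> P E \<Longrightarrow> P (forest_mult E (caret n))"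
  shows "P F"
  using assms(1)
proof (induction "card (inner_nodes F)" arbitrary: F rule: less_induct)
  case less
  show ?case
  proof (cases "F = forest_one")
    case False
    then obtain E n where E: "is_forest E" "F = forest_mult E (caret n)"
      using forest_last_caret less.prems by blast
    then show ?thesis using less.hyps[of E] assms(3) card_inner_nodes_caret by auto
  qed (simp add: assms(2))
qed

section \<open>Deleting and doubling strands\<close>

text \<open>Position of strand \<open>j\<close> after an additional strand has been inserted to the right of strand \<open>i\<close>; for
  \<open>i = j\<close> the value is the position of the inserted strand. As a function of \<open>j\<close> it enumerates the
  positions other than \<open>i\<close> in increasing order.\<close>

definition add_strand :: "nat \<Rightarrow> nat \<Rightarrow> nat" where
  "add_strand i j = (if j < i then j else Suc j)"

text \<open>Position of strand \<open>i\<close> after strand \<open>j\<close> has been removed.\<close>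

definition drop_strand :: "nat \<Rightarrow> nat \<Rightarrow> nat" where
  "drop_strand j i = (if i < j then i else i - 1)"

text \<open>What permutations and braids have in common: an element \<open>\<alpha>\<close> moves position \<open>i\<close> to \<open>perm \<alpha> i\<close>,
  and \<open>del \<alpha> j\<close> is \<open>\<alpha>\<close> without the strand that starts at \<open>j\<close>. In a product \<open>\<alpha> \<otimes> \<beta>\<close> this strand
  arrives at \<open>perm \<beta> j\<close> before it enters \<open>\<alpha>\<close>; hence \<open>del\<close> is a crossed homomorphism.\<close>

locale strand_group = group A for A :: "('a, 'm) monoid_scheme" (structure) +
  fixes \<sigma> :: "nat \<Rightarrow> 'a" and perm :: "'a \<Rightarrow> nat \<Rightarrow> nat" and del :: "'a \<Rightarrow> nat \<Rightarrow> 'a"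
  assumes generated: "generate A (range \<sigma>) = carrier A"
    and perm_mult: "\<lbrakk>\<alpha> \<in> carrier A; \<beta> \<in> carrier A\<rbrakk> \<Longrightarrow> perm (\<alpha> \<otimes> \<beta>) i = perm \<alpha> (perm \<beta> i)"
    and perm_sigma: "perm (\<sigma> q) = perm_gen q"
    and del_closed: "\<alpha> \<in> carrier A \<Longrightarrow> del \<alpha> j \<in> carrier A"
    and del_mult: "\<lbrakk>\<alpha> \<in> carrier A; \<beta> \<in> carrier A\<rbrakk> \<Longrightarrow>
      del (\<alpha> \<otimes> \<beta>) j = del \<alpha> (perm \<beta> j) \<otimes> del \<beta> j"
    and del_sigma: "del (\<sigma> q) j = (if j < q then \<sigma> (q - 1) else if j \<le> q + 1 then \<one> else \<sigma> q)"
begin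

lemma sigma_closed [simp, intro]: "\<sigma> q \<in> carrier A"
  using generate.incl[of "\<sigma> q" "range \<sigma>" A] generated by simp

lemma perm_gen_involution [simp]: "perm_gen q (perm_gen q i) = i"
  by (simp add: perm_gen_def)

lemma perm_one: "perm \<one> i = i"
proof -
  have "perm (\<sigma> 0) (perm \<one> i) = perm (\<sigma> 0) i"
    using perm_mult[of "\<sigma> 0" \<one> i] by simp
  then show ?thesis by (metis perm_gen_involution perm_sigma)
qed

lemma perm_inv_sigma: "perm (inv (\<sigma> q)) i = perm_gen q i"
  using perm_mult[of "\<sigma> q" "inv (\<sigma> q)" i] perm_one
  by (metis perm_gen_involution perm_sigma inv_closed r_inv sigma_closed)

lemma perm_inj:
  assumes "\<alpha> \<in> carrier A" "perm \<alpha> i = perm \<alpha> j"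
  shows "i = j"
  using perm_mult[OF inv_closed[OF assms(1)] assms(1)] assms perm_one by (metis l_inv)

lemma del_one: "del \<one> j = \<one>"
  using del_mult[of \<one> \<one> j] del_closed[of \<one> j] perm_one by (simp add: l_cancel_one')

text \<open>The crossing \<open>\<sigma>\<^sub>q\<close> exchanges the two strands whose deletion gives \<open>\<one>\<close> and fixes all others, so
  deletion commutes with inverting it.\<close>

lemma del_inv_sigma:
  "del (inv (\<sigma> q)) j = (if j < q then inv (\<sigma> (q - 1)) else if j \<le> q + 1 then \<one> else inv (\<sigma> q))"
proof -
  have "del (\<sigma> q) (perm_gen q j) \<otimes> del (inv (\<sigma> q)) j = \<one>"
    using del_mult[of "\<sigma> q" "inv (\<sigma> q)" j] by (simp add: del_one perm_inv_sigma)
  moreover have "del (\<sigma> q) (perm_gen q j) = del (\<sigma> q) j"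
    by (auto simp: del_sigma perm_gen_def transpose_def)
  ultimately have "del (inv (\<sigma> q)) j = inv (del (\<sigma> q) j)"
    using inv_equality[of "del (\<sigma> q) j" "del (inv (\<sigma> q)) j"] inv_comm
    by (metis del_closed inv_closed sigma_closed inv_inv)
  then show ?thesis by (simp add: del_sigma)
qed

lemma strand_induct [consumes 1, case_names one gen mult]:
  assumes "\<alpha> \<in> carrier A" and "P \<one>"
    and "\<And>q \<epsilon>. \<epsilon> \<in> {1, -1} \<Longrightarrow> P (\<sigma> q [^] (\<epsilon> :: int))"
    and "\<And>\<alpha> \<beta>. \<lbrakk>\<alpha> \<in> carrier A; \<beta> \<in> carrier A; P \<alpha>; P \<beta>\<rbrakk> \<Longrightarrow> P (\<alpha> \<otimes> \<beta>)"
  shows "P \<alpha>"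
proof -
  have P: "P (\<sigma> q)" "P (inv (\<sigma> q))" for q
    using assms(3)[of 1 q] assms(3)[of "-1" q] by (simp_all add: int_pow_neg)
  have "\<alpha> \<in> generate A (range \<sigma>)" using assms(1) generated by simp
  then show ?thesis
  proof (induction rule: generate.induct)
    case (eng a b)
    then show ?case using assms(4) by (simp add: generated)
  qed (use assms(2) P in auto)
qed

lemma perm_sigma_pow:
  assumes "\<epsilon> \<in> {1, -1 :: int}"
  shows "perm (\<sigma> q [^] \<epsilon>) i = perm_gen q i"
  using assms by (auto simp: int_pow_neg perm_sigma perm_inv_sigma)

lemma del_sigma_pow:
  assumes "\<epsilon> \<in> {1, -1 :: int}"
  shows "del (\<sigma> q [^] \<epsilon>) j =
    (if j < q then \<sigma> (q - 1) [^] \<epsilon> else if j \<le> q + 1 then \<one> else \<sigma> q [^] \<epsilon>)"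
  using assms by (auto simp: int_pow_neg del_sigma del_inv_sigma)

end

text \<open>The left side is \<open>perm (del (\<sigma> q) j) (drop_strand j i)\<close>: what remains of a transposition when
  position \<open>j\<close> is removed from its domain and the image of \<open>j\<close> from its range.\<close>

lemma perm_gen_drop_strand:
  assumes "i \<noteq> j"
  shows "(if j < q then perm_gen (q - 1) (drop_strand j i) else
      if j \<le> q + 1 then drop_strand j i else perm_gen q (drop_strand j i))
    = drop_strand (perm_gen q j) (perm_gen q i)"
proof -
  have g: "perm_gen q k = (if k = q then Suc q else if k = Suc q then q else k)" for q k
    by (simp add: perm_gen_def transpose_def)
  consider "j < q" | "j = q" | "j = Suc q" | "Suc q < j" by linarith
  then show ?thesis
  proof cases
    case 1
    then have "drop_strand j i = q - 1 \<longleftrightarrow> i = q" "drop_strand j i = q \<longleftrightarrow> i = Suc q"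
      using assms by (auto simp: drop_strand_def)
    then show ?thesis using 1 assms by (simp add: g) (auto simp: drop_strand_def)
  next
    case 4
    then have "drop_strand j i = q \<longleftrightarrow> i = q" "drop_strand j i = Suc q \<longleftrightarrow> i = Suc q"
      using assms by (auto simp: drop_strand_def)
    then show ?thesis using 4 assms by (simp add: g) (auto simp: drop_strand_def)
  qed (use assms in \<open>auto simp: g drop_strand_def\<close>)
qed

lemma carrier_Forests [simp]: "F \<in> carrier Forests \<longleftrightarrow> is_forest F"
  by (simp add: Forests_def)

lemma mult_Forests: "F \<otimes>\<^bsub>Forests\<^esub> G = forest_mult F G"
  by (simp add: Forests_def)

lemma one_Forests: "\<one>\<^bsub>Forests\<^esub> = forest_one"
  by (simp add: Forests_def)

locale strand_zappa_szep = zappa_szep A \<sigma> act res + strand_group A \<sigma> perm del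
  for A :: "('a, 'm) monoid_scheme" (structure) and \<sigma> act res perm del
begin

lemma act_caret:
  assumes "\<alpha> \<in> carrier A"
  shows "act \<alpha> (caret i) = caret (perm \<alpha> i)"
  using assms
proof (induction arbitrary: i rule: strand_induct)
  case one then show ?case by (simp add: one_act is_forest_caret perm_one)
next
  case (gen q \<epsilon>) then show ?case by (simp only: act_gen perm_sigma_pow)
next
  case (mult \<alpha> \<beta>) then show ?case by (simp add: mult_act is_forest_caret perm_mult)
qed

text \<open>\<open>\<alpha>\<^bsup>\<lambda>\<^sub>i\<^esup>\<close> is \<open>\<alpha>\<close> with the strand that starts at \<open>i\<close> replaced by two parallel ones, starting at \<open>i\<close>
  and \<open>i + 1\<close>.\<close>

abbreviation dbl :: "'a \<Rightarrow> nat \<Rightarrow> 'a" where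
  "dbl \<alpha> i \<equiv> res \<alpha> (caret i)"

lemma dbl_closed: "\<alpha> \<in> carrier A \<Longrightarrow> dbl \<alpha> i \<in> carrier A"
  by (simp add: res_closed is_forest_caret)

lemma dbl_one: "dbl \<one> i = \<one>"
  by (simp add: one_res is_forest_caret)

text \<open>Doubling is a crossed homomorphism for the same reason as deletion. So the identities between
  \<open>perm\<close>, \<open>del\<close> and \<open>dbl\<close> that follow need a calculation for the generators only.\<close>

lemma dbl_mult:
  assumes "\<alpha> \<in> carrier A" "\<beta> \<in> carrier A"
  shows "dbl (\<alpha> \<otimes> \<beta>) i = dbl \<alpha> (perm \<beta> i) \<otimes> dbl \<beta> i"
  using assms by (simp add: mult_res is_forest_caret act_caret)

lemma perm_dbl_same:
  assumes "\<alpha> \<in> carrier A"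
  shows "perm (dbl \<alpha> i) i = perm \<alpha> i"
  using assms
proof (induction arbitrary: i rule: strand_induct)
  case one then show ?case by (simp add: dbl_one)
next
  case (gen q \<epsilon>)
  then show ?case
    by (simp add: res_gen perm_mult perm_sigma_pow del: insert_iff) (auto simp: perm_gen_def transpose_def)
next
  case (mult \<alpha> \<beta>) then show ?case by (simp add: dbl_mult perm_mult dbl_closed)
qed

lemma perm_dbl_other:
  assumes "\<alpha> \<in> carrier A" "i \<noteq> j"
  shows "perm (dbl \<alpha> i) (add_strand i j) = add_strand (perm \<alpha> i) (perm \<alpha> j)"
  using assms
proof (induction arbitrary: i j rule: strand_induct)
  case one then show ?case by (simp add: dbl_one perm_one)
next
  case (gen q \<epsilon>)
  then show ?case
    by (simp add: res_gen perm_mult perm_sigma_pow del: insert_iff)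
      (auto simp: perm_gen_def transpose_def add_strand_def)
next
  case (mult \<alpha> \<beta>)
  moreover have "perm \<beta> i \<noteq> perm \<beta> j" using mult perm_inj by blast
  ultimately show ?case by (simp add: dbl_mult perm_mult dbl_closed)
qed

lemma perm_del:
  assumes "\<alpha> \<in> carrier A" "i \<noteq> j"
  shows "perm (del \<alpha> j) (drop_strand j i) = drop_strand (perm \<alpha> j) (perm \<alpha> i)"
  using assms
proof (induction arbitrary: i j rule: strand_induct)
  case one then show ?case by (simp add: del_one perm_one)
next
  case (gen q \<epsilon>)
  then have "perm (del (\<sigma> q [^] \<epsilon>) j) k =
      (if j < q then perm_gen (q - 1) k else if j \<le> q + 1 then k else perm_gen q k)" for k
    by (simp add: del_sigma_pow perm_one perm_sigma_pow del: insert_iff)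
  then show ?case
    using gen perm_gen_drop_strand[of i j q] by (simp add: perm_sigma_pow del: insert_iff)
next
  case (mult \<alpha> \<beta>)
  moreover have "perm \<beta> i \<noteq> perm \<beta> j" using mult perm_inj by blast
  ultimately show ?case by (simp add: del_mult perm_mult del_closed)
qed

text \<open>Deleting one of two parallel strands undoes the doubling.\<close>

lemma del_dbl_same:
  assumes "\<alpha> \<in> carrier A"
  shows "del (dbl \<alpha> i) i = \<alpha>"
  using assms
proof (induction arbitrary: i rule: strand_induct)
  case one then show ?case by (simp add: dbl_one del_one)
next
  case (gen q \<epsilon>)
  then show ?case
    by (simp add: res_gen del_mult perm_sigma_pow del_sigma_pow del: insert_iff)
      (auto simp: perm_gen_def transpose_def)
next
  case (mult \<alpha> \<beta>) then show ?case by (simp add: dbl_mult del_mult dbl_closed perm_dbl_same)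
qed

text \<open>Doubling one strand and deleting another one commute, up to the renumbering of both.\<close>

lemma del_dbl_other:
  assumes "\<alpha> \<in> carrier A" "i \<noteq> j"
  shows "del (dbl \<alpha> i) (add_strand i j) = dbl (del \<alpha> j) (drop_strand j i)"
  using assms
proof (induction arbitrary: i j rule: strand_induct)
  case one then show ?case by (simp add: dbl_one del_one)
next
  case (gen q \<epsilon>)
  \<comment> \<open>One sign at a time: \<open>s q\<close> obeys the same rules whether it stands for \<open>\<sigma> q\<close> or its inverse.\<close>
  define s where "s q = \<sigma> q [^] \<epsilon>" for q
  have s: "s q \<in> carrier A" for q using gen(1) by (simp add: s_def)
  have p: "perm (s q) k = (if k = q then Suc q else if k = Suc q then q else k)" for q k
    using gen(1) by (simp add: s_def perm_sigma_pow perm_gen_def transpose_def del: insert_iff)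
  have d: "del (s q) k = (if k < q then s (q - 1) else if k \<le> Suc q then \<one> else s q)" for q k
    using gen(1) by (simp add: s_def del_sigma_pow del: insert_iff)
  have r: "dbl (s q) k = (if k < q then s (Suc q) else if k = q then s q \<otimes> s (Suc q)
      else if k = Suc q then s (Suc q) \<otimes> s q else s q)" for q k
    using gen(1) by (simp add: s_def res_gen del: insert_iff)
  note simps = s p d r del_mult dbl_one add_strand_def drop_strand_def
  have "del (dbl (s q) i) (add_strand i j) = dbl (del (s q) j) (drop_strand j i)"
  proof -
    consider "i < q" | "i = q" | "i = Suc q" | "Suc q < i" by linarith
    then show ?thesis
    proof cases
      case 1
      consider "j < i" "i - 1 < q - 1" | "i < j" "j < q" "i < q - 1"
        | "j = q" | "j = Suc q" | "Suc q < j"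
        using gen(2) 1 by arith
      then show ?thesis using 1 by cases (simp_all add: simps)
    next
      case 2
      consider "j < q" | "j = Suc q" | "Suc q < j" using gen(2) 2 by linarith
      then show ?thesis using 2 by cases (simp_all add: simps)
    next
      case 3
      show ?thesis
      proof (cases "j < q")
        case True
        then obtain q' where "q = Suc q'" by (cases q) auto
        then show ?thesis using 3 True by (simp add: simps)
      next
        case False
        then consider "j = q" | "Suc q < j" using gen(2) 3 by linarith
        then show ?thesis using 3 by cases (simp_all add: simps)
      qed
    next
      case 4
      then obtain i' where i': "i = Suc i'" by (cases i) auto
      show ?thesis
      proof (cases "j < q")
        case True
        then obtain q' where "q = Suc q'" by (cases q) auto
        then show ?thesis using 4 i' True by (simp add: simps)
      next
        case False
        then consider "j = q" | "j = Suc q" | "Suc q < j" "j < i" | "i < j"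
          using gen(2) 4 by linarith
        then show ?thesis using 4 i' by cases (simp_all add: simps)
      qed
    qed
  qed
  then show ?case by (simp add: s_def)
next
  case (mult \<alpha> \<beta>)
  moreover have "perm \<beta> i \<noteq> perm \<beta> j" using mult perm_inj by blast
  ultimately show ?case
    by (simp add: dbl_mult del_mult dbl_closed del_closed perm_dbl_other perm_del)
qed

text \<open>The common element has two parallel strands from \<open>i\<close> on and two from \<open>k + 1\<close> on. Deleting one
  strand of the second pair yields \<open>\<beta>\<close>; deleting one strand of the first pair yields \<open>\<alpha>\<close>. Doing both
  yields \<open>\<gamma>\<close>, which is \<open>\<alpha>\<close> with the strand \<open>k\<close> deleted.\<close>

lemma dbl_eq_dbl:
  assumes \<alpha>: "\<alpha> \<in> carrier A" and \<beta>: "\<beta> \<in> carrier A"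
    and eq: "dbl \<alpha> i = dbl \<beta> (Suc k)" and less: "i < k"
  shows "\<exists>\<gamma>\<in>carrier A. \<alpha> = dbl \<gamma> k \<and> \<beta> = dbl \<gamma> i"
proof (intro bexI conjI)
  let ?\<gamma> = "del \<alpha> k"
  show \<gamma>: "?\<gamma> \<in> carrier A" using \<alpha> by (rule del_closed)
  have "\<beta> = del (dbl \<alpha> i) (Suc k)" using del_dbl_same[OF \<beta>, of "Suc k"] eq by simp
  also have "\<dots> = dbl ?\<gamma> i"
    using del_dbl_other[OF \<alpha>, of i k] less by (simp add: add_strand_def drop_strand_def)
  finally show \<beta>': "\<beta> = dbl ?\<gamma> i" .
  have "\<alpha> = del (dbl \<beta> (Suc k)) i" using del_dbl_same[OF \<alpha>, of i] eq by simp
  also have "\<dots> = dbl (del \<beta> i) k"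
    using del_dbl_other[OF \<beta>, of "Suc k" i] less by (simp add: add_strand_def drop_strand_def)
  also have "del \<beta> i = ?\<gamma>" using \<beta>' del_dbl_same[OF \<gamma>, of i] by simp
  finally show "\<alpha> = dbl ?\<gamma> k" .
qed

end

section \<open>The product monoid inside a group of fractions\<close>

locale zs_fractions = strand_zappa_szep A \<sigma> act res perm del
  for A :: "('a, 'm) monoid_scheme" (structure) and \<sigma> act res perm del +
  fixes Q :: "('g, 'n) monoid_scheme" and \<iota> :: "forest \<times> 'a \<Rightarrow> 'g"
  assumes fractions: "group_of_right_fractions (zs_product A act res) Q \<iota>"
begin

abbreviation M :: "(forest \<times> 'a) monoid" where
  "M \<equiv> zs_product A act res"

abbreviation M_mult (infixl \<open>\<odot>\<close> 70) where
  "p \<odot> q \<equiv> p \<otimes>\<^bsub>M\<^esub> q"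

abbreviation of_forest :: "forest \<Rightarrow> forest \<times> 'a" where
  "of_forest F \<equiv> (F, \<one>)"

lemma carrier_M [simp]: "(F, \<alpha>) \<in> carrier M \<longleftrightarrow> is_forest F \<and> \<alpha> \<in> carrier A"
  by (simp add: zs_product_def)

lemma mult_M: "(F, \<alpha>) \<odot> (G, \<beta>) = (forest_mult F (act \<alpha> G), res \<alpha> G \<otimes> \<beta>)"
  by (simp add: zs_product_def mult_Forests)

lemma is_forest_act: "\<alpha> \<in> carrier A \<Longrightarrow> is_forest F \<Longrightarrow> is_forest (act \<alpha> F)"
  using act_closed by simp

lemma M_closed:
  assumes "p \<in> carrier M" "q \<in> carrier M"
  shows "p \<odot> q \<in> carrier M"
  using assms by (cases p; cases q) (simp add: mult_M is_forest_act is_forest_mult res_closed)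

sublocale Q: group Q
  using fractions by (simp add: group_of_right_fractions_def)

lemma \<iota>_closed [simp]: "p \<in> carrier M \<Longrightarrow> \<iota> p \<in> carrier Q"
  and \<iota>_mult: "p \<in> carrier M \<Longrightarrow> q \<in> carrier M \<Longrightarrow> \<iota> (p \<odot> q) = \<iota> p \<otimes>\<^bsub>Q\<^esub> \<iota> q"
  and \<iota>_inject: "p \<in> carrier M \<Longrightarrow> q \<in> carrier M \<Longrightarrow> \<iota> p = \<iota> q \<longleftrightarrow> p = q"
  using fractions by (auto simp: group_of_right_fractions_def hom_def dest: inj_onD)

text \<open>Associativity and cancellation are read off in the group \<open>Q\<close>; only the closure of \<open>M\<close> under the
  product had to be established beforehand.\<close>

lemma M_assoc:
  assumes "p \<in> carrier M" "q \<in> carrier M" "r \<in> carrier M"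
  shows "p \<odot> q \<odot> r = p \<odot> (q \<odot> r)"
proof -
  have "\<iota> (p \<odot> q \<odot> r) = \<iota> (p \<odot> (q \<odot> r))"
    using assms by (simp add: \<iota>_mult M_closed Q.m_assoc)
  then show ?thesis using assms by (simp add: \<iota>_inject M_closed)
qed

lemma M_right_cancel:
  assumes "p \<in> carrier M" "q \<in> carrier M" "r \<in> carrier M" "p \<odot> r = q \<odot> r"
  shows "p = q"
proof -
  have "\<iota> p \<otimes>\<^bsub>Q\<^esub> \<iota> r = \<iota> q \<otimes>\<^bsub>Q\<^esub> \<iota> r" using assms by (simp flip: \<iota>_mult)
  then show ?thesis using assms by (simp add: \<iota>_inject)
qed

lemma mult_of_forest:
  "\<alpha> \<in> carrier A \<Longrightarrow> is_forest G \<Longrightarrow> (F, \<alpha>) \<odot> of_forest G = (forest_mult F (act \<alpha> G), res \<alpha> G)"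
  by (simp add: mult_M res_closed)

lemma of_forest_mult:
  "is_forest G \<Longrightarrow> \<beta> \<in> carrier A \<Longrightarrow> of_forest F \<odot> (G, \<beta>) = (forest_mult F G, \<beta>)"
  by (simp add: mult_M one_act one_res)

lemma forest_mult_one: "forest_mult F forest_one = F"
  by (auto simp: forest_mult_def forest_one_def leaves_def)

lemma mult_strands:
  "\<alpha> \<in> carrier A \<Longrightarrow> (F, \<alpha>) \<odot> (forest_one, \<beta>) = (F, \<alpha> \<otimes> \<beta>)"
  using act_one[of \<alpha>] res_one[of \<alpha>] by (simp add: mult_M one_Forests forest_mult_one)

lemma mult_one_M: "p \<in> carrier M \<Longrightarrow> p \<odot> of_forest forest_one = p"
  by (cases p) (simp add: mult_strands)

lemma mult_caret_M:
  "\<alpha> \<in> carrier A \<Longrightarrow>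
    (F, \<alpha>) \<odot> of_forest (caret i) = (forest_mult F (caret (perm \<alpha> i)), dbl \<alpha> i)"
  by (simp add: mult_of_forest is_forest_caret act_caret)

lemma forest_assoc:
  assumes "is_forest F" "is_forest G" "is_forest H"
  shows "forest_mult (forest_mult F G) H = forest_mult F (forest_mult G H)"
  using M_assoc[of "of_forest F" "of_forest G" "of_forest H"] assms
  by (simp add: of_forest_mult is_forest_mult)

lemma forest_right_cancel:
  assumes "is_forest F" "is_forest G" "is_forest H" "forest_mult F H = forest_mult G H"
  shows "F = G"
  using M_right_cancel[of "of_forest F" "of_forest G" "of_forest H"] assms
  by (simp add: of_forest_mult)

text \<open>The trivial forest is idempotent, so its image in \<open>Q\<close> is the identity.\<close>

lemma forest_one_mult:
  assumes "is_forest F"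
  shows "forest_mult forest_one F = F"
proof -
  let ?e = "of_forest forest_one"
  have e: "?e \<in> carrier M" by (simp add: is_forest_one)
  have "?e \<odot> ?e = ?e" by (simp add: of_forest_mult is_forest_one forest_mult_one)
  then have "\<iota> ?e \<otimes>\<^bsub>Q\<^esub> \<iota> ?e = \<iota> ?e" using e by (simp flip: \<iota>_mult)
  then have "\<iota> ?e = \<one>\<^bsub>Q\<^esub>" using e Q.l_cancel_one' \<iota>_closed by metis
  then have "\<iota> (?e \<odot> of_forest F) = \<iota> (of_forest F)"
    using e assms by (simp add: \<iota>_mult)
  then show ?thesis using e assms by (simp add: \<iota>_inject M_closed of_forest_mult is_forest_mult)
qed

section \<open>The length of a forest\<close>

lemma foldr_carets_append:
  assumes "is_forest G"
  shows "is_forest (foldr forest_mult (map caret is) G)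
    \<and> foldr forest_mult (map caret is) G
      = forest_mult (foldr forest_mult (map caret is) forest_one) G"
proof (induction "is")
  case (Cons i "is")
  have one: "is_forest (foldr forest_mult (map caret is) forest_one)"
    by (induction "is") (simp_all add: is_forest_one is_forest_mult is_forest_caret)
  show ?case
    using Cons one assms by (simp add: is_forest_mult is_forest_caret forest_assoc)
qed (simp add: assms forest_one_mult)

lemma card_inner_nodes_foldr:
  "card (inner_nodes (foldr forest_mult (map caret is) forest_one)) = length is"
proof (induction "is" rule: rev_induct)
  case (snoc i "is")
  have "foldr forest_mult (map caret (is @ [i])) forest_one
      = forest_mult (foldr forest_mult (map caret is) forest_one) (caret i)"
    using foldr_carets_append[OF is_forest_caret, of "is" i] by (simp add: forest_mult_one)
  then show ?case
    using snoc foldr_carets_append[OF is_forest_one, of "is"] by (simp add: card_inner_nodes_caret)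
qed (simp add: inner_nodes_one)

lemma forest_length_eq:
  assumes "is_forest F"
  shows "forest_length F = card (inner_nodes F)"
proof -
  have "\<exists>is. F = foldr forest_mult (map caret is) forest_one"
    using assms
  proof (induction rule: forest_caret_induct)
    case one
    show ?case by (rule exI[of _ "[]"]) simp
  next
    case (caret E n)
    then obtain "is" where "E = foldr forest_mult (map caret is) forest_one" by blast
    then have "forest_mult E (caret n) = foldr forest_mult (map caret (is @ [n])) forest_one"
      using foldr_carets_append[OF is_forest_caret, of "is" n] by (simp add: forest_mult_one)
    then show ?case by blast
  qed
  then obtain "is" where "F = foldr forest_mult (map caret is) forest_one" by blast
  then have "\<exists>is. length is = n \<and> F = foldr forest_mult (map caret is) forest_one \<Longrightarrow>
      n = card (inner_nodes F)"
    and "\<exists>is. length is = card (inner_nodes F) \<and> F = foldr forest_mult (map caret is) forest_one" for n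
    using card_inner_nodes_foldr by metis+
  then show ?thesis unfolding forest_length_def by (intro the_equality)
qed

lemma forest_length_mult_caret:
  "is_forest F \<Longrightarrow> forest_length (forest_mult F (caret n)) = Suc (forest_length F)"
  by (simp add: forest_length_eq is_forest_mult is_forest_caret card_inner_nodes_caret)

lemma forest_length_le_mult:
  "is_forest F \<Longrightarrow> is_forest G \<Longrightarrow> forest_length F \<le> forest_length (forest_mult F G)"
  by (simp add: forest_length_eq is_forest_mult card_mono finite_inner_nodes inner_nodes_mult)

lemma forest_mult_eq_self:
  assumes F: "is_forest F" and G: "is_forest G" and eq: "forest_mult F G = F"
  shows "G = forest_one"
proof (rule ccontr)
  assume "G \<noteq> forest_one"
  then obtain E n where E: "is_forest E" "G = forest_mult E (caret n)"
    using forest_last_caret[OF G] by blast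
  then have "forest_length F = Suc (forest_length (forest_mult F E))"
    using F eq forest_length_mult_caret[of "forest_mult F E" n]
    by (simp add: forest_assoc is_forest_caret is_forest_mult)
  then show False using forest_length_le_mult[OF F E(1)] by simp
qed

section \<open>Confluence of caret removal\<close>

text \<open>The forest parts of \<open>p\<close> and \<open>q\<close> acquire carets at the leaves \<open>perm \<alpha> i\<close> and \<open>perm \<beta> j\<close>, which may
  come in either order; the strand parts come from one \<open>\<gamma>\<close> by \<open>dbl_eq_dbl\<close>, whose gap \<open>i + 2 \<le> j\<close>
  is provided by the forests \<open>S\<close> and \<open>T\<close>. The element \<open>r\<close> is the pair of the two solutions, once the
  indices of the carets are seen to agree with the values of \<open>\<gamma>\<close>.\<close>

lemma mult_caret_diamond_M_ordered:
  assumes p: "p \<in> carrier M" and q: "q \<in> carrier M" and S: "is_forest S" and T: "is_forest T"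
    and pq: "p \<odot> of_forest (caret i) = q \<odot> of_forest (caret j)"
    and ST: "forest_mult S (caret i) = forest_mult T (caret j)" and less: "i < j"
  shows "\<exists>r\<in>carrier M. \<exists>R k l. is_forest R \<and> p = r \<odot> of_forest (caret k) \<and> S = forest_mult R (caret k)
    \<and> q = r \<odot> of_forest (caret l) \<and> T = forest_mult R (caret l)"
proof -
  obtain U \<alpha> W \<beta> where p_eq: "p = (U, \<alpha>)" and q_eq: "q = (W, \<beta>)" by (cases p, cases q)
  then have U: "is_forest U" and W: "is_forest W" and \<alpha>: "\<alpha> \<in> carrier A" and \<beta>: "\<beta> \<in> carrier A"
    using p q by auto
  obtain R where R: "is_forest R" "S = forest_mult R (caret (j - 1))" "T = forest_mult R (caret i)"
    and "i + 2 \<le> j"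
    using mult_caret_diamond[OF S T ST less] by blast
  then obtain k where j: "j = Suc k" "i < k" by (cases j) auto
  have UW: "forest_mult U (caret (perm \<alpha> i)) = forest_mult W (caret (perm \<beta> j))"
    and dbl: "dbl \<alpha> i = dbl \<beta> (Suc k)"
    using pq \<alpha> \<beta> by (simp_all add: p_eq q_eq mult_caret_M j(1))
  obtain \<gamma> where \<gamma>: "\<gamma> \<in> carrier A" "\<alpha> = dbl \<gamma> k" "\<beta> = dbl \<gamma> i"
    using dbl_eq_dbl[OF \<alpha> \<beta> dbl j(2)] by blast
  have perms: "perm \<alpha> k = perm \<gamma> k" "perm \<beta> i = perm \<gamma> i"
    using perm_dbl_same[OF \<gamma>(1)] \<gamma>(2,3) by simp_all
  \<comment> \<open>Both facts follow the strands \<open>i\<close> and \<open>j\<close> of the common element, once as half of a double strand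
    and once as a single strand beside the other pair.\<close>
  have a: "perm \<alpha> i = add_strand (perm \<beta> j) (perm \<gamma> i)"
    using perm_dbl_same[OF \<alpha>, of i] perm_dbl_other[OF \<beta>, of "Suc k" i] dbl j perms
    by (simp add: add_strand_def)
  have b: "perm \<beta> j = add_strand (perm \<alpha> i) (perm \<gamma> k)"
    using perm_dbl_same[OF \<beta>, of "Suc k"] perm_dbl_other[OF \<alpha>, of i k] dbl j perms
    by (simp add: add_strand_def)
  have below: "g = x" if "x = add_strand y g" "x < y" for x y g
    using that by (simp add: add_strand_def split: if_splits)
  have above: "g = x - 1" if "x = add_strand y g" "y < x" for x y g
    using that by (simp add: add_strand_def split: if_splits)
  have neq: "x \<noteq> y" if "x = add_strand y g" for x y g
    using that by (simp add: add_strand_def)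
  have "\<exists>X. is_forest X \<and> U = forest_mult X (caret (perm \<gamma> k)) \<and> W = forest_mult X (caret (perm \<gamma> i))"
  proof (cases "perm \<alpha> i < perm \<beta> j")
    case True
    then have "perm \<gamma> i = perm \<alpha> i" "perm \<gamma> k = perm \<beta> j - 1"
      using below[OF a] above[OF b] by blast+
    then show ?thesis using mult_caret_diamond[OF U W UW True] by auto
  next
    case False
    then have "perm \<beta> j < perm \<alpha> i" using neq[OF a] by simp
    moreover from this have "perm \<gamma> i = perm \<alpha> i - 1" "perm \<gamma> k = perm \<beta> j"
      using above[OF a] below[OF b] by blast+
    ultimately show ?thesis using mult_caret_diamond[OF W U UW[symmetric]] by auto
  qed
  then obtain X where X: "is_forest X" "U = forest_mult X (caret (perm \<gamma> k))"
    "W = forest_mult X (caret (perm \<gamma> i))" by blast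
  have r: "(X, \<gamma>) \<in> carrier M" "p = (X, \<gamma>) \<odot> of_forest (caret k)" "q = (X, \<gamma>) \<odot> of_forest (caret i)"
    using X \<gamma> by (simp_all add: p_eq q_eq mult_caret_M)
  show ?thesis
    by (rule bexI[of _ "(X, \<gamma>)"], rule exI[of _ R], rule exI[of _ k], rule exI[of _ i])
      (use R j r in simp_all)
qed

lemma mult_caret_diamond_M:
  assumes "p \<in> carrier M" "q \<in> carrier M" "is_forest S" "is_forest T"
    and "p \<odot> of_forest (caret i) = q \<odot> of_forest (caret j)"
    and "forest_mult S (caret i) = forest_mult T (caret j)" and "i \<noteq> j"
  shows "\<exists>r\<in>carrier M. \<exists>R k l. is_forest R \<and> p = r \<odot> of_forest (caret k) \<and> S = forest_mult R (caret k)
    \<and> q = r \<odot> of_forest (caret l) \<and> T = forest_mult R (caret l)"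
proof (cases "i < j")
  case True
  then show ?thesis using mult_caret_diamond_M_ordered assms by blast
next
  case False
  then show ?thesis
    using mult_caret_diamond_M_ordered[OF assms(2,1,4,3) assms(5,6)[symmetric]] assms(7) by fastforce
qed

definition reducible :: "forest \<times> 'a \<Rightarrow> forest \<Rightarrow> bool" where
  "reducible p H \<longleftrightarrow> (\<exists>p'\<in>carrier M. \<exists>H' i. is_forest H' \<and>
    p = p' \<odot> of_forest (caret i) \<and> H = forest_mult H' (caret i))"

text \<open>Confluence, by induction on the length of the common multiple. Strip the last carets from \<open>R\<close> and
  \<open>S\<close>, which gives two smaller multiples, one of \<open>(a, H)\<close> and one of \<open>(p, K)\<close>. The diamond gives
  a pair \<open>(r, D)\<close> below both. By induction \<open>(r, D)\<close> is a multiple of \<open>(a, H)\<close>; therefore so is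
  the second pair, and the induction hypothesis applies to it again. As \<open>(a, H)\<close> is reduced,
  \<open>R\<close> cannot run out of carets before \<open>S\<close> does.\<close>

lemma reduced_divides:
  assumes "a \<in> carrier M" "is_forest H" "\<not> reducible a H"
    and "p \<in> carrier M" "is_forest K" "is_forest R" "is_forest S"
    and "a \<odot> of_forest R = p \<odot> of_forest S" "forest_mult H R = forest_mult K S"
  shows "\<exists>J. is_forest J \<and> p = a \<odot> of_forest J \<and> K = forest_mult H J"
  using assms(4-)
proof (induction "forest_length (forest_mult H R)" arbitrary: p K R S rule: less_induct)
  case less
  note a = assms(1-3) and prems = less.prems
  have step: "(b \<odot> of_forest E) \<odot> of_forest (caret n) = b \<odot> of_forest (forest_mult E (caret n))"
    if "b \<in> carrier M" "is_forest E" for b E n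
    using that by (simp add: M_assoc is_forest_caret of_forest_mult)
  show ?case
  proof (cases "S = forest_one")
    case True
    then have "p = a \<odot> of_forest R" "K = forest_mult H R"
      using prems by (simp_all add: mult_one_M forest_mult_one)
    then show ?thesis using prems(3) by blast
  next
    case S: False
    have "R \<noteq> forest_one"
    proof
      assume "R = forest_one"
      then have aH: "a = p \<odot> of_forest S" "H = forest_mult K S"
        using prems(5,6) a(1) by (simp_all add: mult_one_M forest_mult_one)
      obtain S' j where S': "is_forest S'" "S = forest_mult S' (caret j)"
        using forest_last_caret[OF prems(4) S] by blast
      have "a = (p \<odot> of_forest S') \<odot> of_forest (caret j)"
        using aH(1) S' step[OF prems(1)] by simp
      moreover have "H = forest_mult (forest_mult K S') (caret j)"
        using aH(2) S' prems(2) by (simp add: forest_assoc is_forest_caret)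
      moreover have "p \<odot> of_forest S' \<in> carrier M" "is_forest (forest_mult K S')"
        using prems S'(1) by (simp_all add: M_closed is_forest_mult)
      ultimately show False using a(3) unfolding reducible_def by blast
    qed
    then obtain R' i S' j where R': "is_forest R'" "R = forest_mult R' (caret i)"
      and S': "is_forest S'" "S = forest_mult S' (caret j)"
      using forest_last_caret prems(3,4) S by metis
    let ?p1 = "a \<odot> of_forest R'" and ?T1 = "forest_mult H R'"
    let ?p2 = "p \<odot> of_forest S'" and ?T2 = "forest_mult K S'"
    have closed: "?p1 \<in> carrier M" "?p2 \<in> carrier M" "is_forest ?T1" "is_forest ?T2"
      using a prems R' S' by (simp_all add: M_closed is_forest_mult)
    have eqs: "?p1 \<odot> of_forest (caret i) = ?p2 \<odot> of_forest (caret j)"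
      "forest_mult ?T1 (caret i) = forest_mult ?T2 (caret j)"
      using prems R' S' a step by (simp_all add: forest_assoc is_forest_caret)
    have shorter: "forest_length ?T1 < forest_length (forest_mult H R)"
      "forest_length ?T2 < forest_length (forest_mult H R)"
      using eqs(2) closed forest_length_mult_caret[of ?T1 i] forest_length_mult_caret[of ?T2 j] R' a
      by (simp_all add: forest_assoc is_forest_caret)
    show ?thesis
    proof (cases "i = j")
      case True
      then have "?p1 = ?p2" "?T1 = ?T2"
        using eqs closed M_right_cancel[of ?p1 ?p2 "of_forest (caret i)"]
          forest_right_cancel[of ?T1 ?T2 "caret i"] by (simp_all add: is_forest_caret)
      then show ?thesis using less.hyps[OF shorter(1) prems(1,2) R'(1) S'(1)] by blast
    next
      case False
      then obtain r D k l where r: "r \<in> carrier M" "is_forest D"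
        and k: "?p1 = r \<odot> of_forest (caret k)" "?T1 = forest_mult D (caret k)"
        and l: "?p2 = r \<odot> of_forest (caret l)" "?T2 = forest_mult D (caret l)"
        using mult_caret_diamond_M[OF closed eqs] by blast
      obtain J where J: "is_forest J" "r = a \<odot> of_forest J" "D = forest_mult H J"
        using less.hyps[OF shorter(1) r R'(1) is_forest_caret k] by blast
      let ?J = "forest_mult J (caret l)"
      have J': "is_forest ?J" "a \<odot> of_forest ?J = ?p2" "forest_mult H ?J = ?T2"
        using J l a step by (simp_all add: is_forest_mult is_forest_caret forest_assoc)
      then show ?thesis using less.hyps[of ?J p K S'] shorter(2) prems(1,2) S'(1) by simp
    qed
  qed
qed

section \<open>Reduced triples\<close>

lemma fraction_cancel:
  assumes "p \<in> carrier M" "q \<in> carrier M" "r \<in> carrier M"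
  shows "fraction Q \<iota> (p \<odot> r) (q \<odot> r) = fraction Q \<iota> p q"
proof -
  have "inv\<^bsub>Q\<^esub> (\<iota> q \<otimes>\<^bsub>Q\<^esub> \<iota> r) = inv\<^bsub>Q\<^esub> \<iota> r \<otimes>\<^bsub>Q\<^esub> inv\<^bsub>Q\<^esub> \<iota> q"
    using assms by (simp add: Q.inv_mult_group)
  then show ?thesis
    using assms
    by (simp add: fraction_def \<iota>_mult Q.m_assoc flip: Q.m_assoc[of "\<iota> r" "inv\<^bsub>Q\<^esub> \<iota> r"])
qed

lemma fraction_eqD:
  assumes "p \<in> carrier M" "q \<in> carrier M" "p' \<in> carrier M" "q' \<in> carrier M"
    and r: "r \<in> carrier M" and s: "s \<in> carrier M"
    and eq: "fraction Q \<iota> p q = fraction Q \<iota> p' q'" "q \<odot> r = q' \<odot> s"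
  shows "p \<odot> r = p' \<odot> s"
proof -
  have num: "fraction Q \<iota> a b \<otimes>\<^bsub>Q\<^esub> \<iota> (b \<odot> c) = \<iota> (a \<odot> c)"
    if "a \<in> carrier M" "b \<in> carrier M" "c \<in> carrier M" for a b c
  proof -
    have "inv\<^bsub>Q\<^esub> \<iota> b \<otimes>\<^bsub>Q\<^esub> (\<iota> b \<otimes>\<^bsub>Q\<^esub> \<iota> c) = \<iota> c"
      using that by (simp flip: Q.m_assoc)
    then show ?thesis using that by (simp add: fraction_def \<iota>_mult Q.m_assoc)
  qed
  have "\<iota> (p \<odot> r) = \<iota> (p' \<odot> s)"
    using num[of p q r] num[of p' q' s] assms by simp
  then show ?thesis using assms by (simp add: \<iota>_inject M_closed)
qed

text \<open>Write \<open>inv p \<otimes> q\<close> as a fraction \<open>r \<otimes> inv s\<close> and clear the denominators.\<close>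

lemma common_right_multiple:
  assumes p: "p \<in> carrier M" and q: "q \<in> carrier M"
  shows "\<exists>r\<in>carrier M. \<exists>s\<in>carrier M. p \<odot> r = q \<odot> s"
proof -
  have "inv\<^bsub>Q\<^esub> \<iota> p \<otimes>\<^bsub>Q\<^esub> \<iota> q \<in> carrier Q" using p q by simp
  then obtain r s where rs: "r \<in> carrier M" "s \<in> carrier M"
    and "inv\<^bsub>Q\<^esub> \<iota> p \<otimes>\<^bsub>Q\<^esub> \<iota> q = fraction Q \<iota> r s"
    using fractions unfolding group_of_right_fractions_def by blast
  then have "inv\<^bsub>Q\<^esub> \<iota> p \<otimes>\<^bsub>Q\<^esub> \<iota> q \<otimes>\<^bsub>Q\<^esub> \<iota> s = \<iota> r"
    by (simp add: fraction_def Q.m_assoc)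
  then have "\<iota> q \<otimes>\<^bsub>Q\<^esub> \<iota> s = \<iota> p \<otimes>\<^bsub>Q\<^esub> \<iota> r"
    using p q rs by (metis Q.inv_solve_left' Q.m_assoc Q.inv_closed Q.m_closed \<iota>_closed)
  then have "p \<odot> r = q \<odot> s"
    using p q rs by (simp flip: \<iota>_mult add: \<iota>_inject M_closed)
  then show ?thesis using rs by blast
qed

text \<open>Cancelling the invertible element \<open>\<kappa>\<close> makes the denominator a forest; \<open>p\<close> and \<open>(K, \<kappa>)\<close> are recovered
  from the new fraction by multiplying with \<open>\<kappa>\<close>.\<close>

lemma of_forest_denominator:
  assumes p: "p \<in> carrier M" and q: "(K, \<kappa>) \<in> carrier M"
  obtains p' where "p' \<in> carrier M" "p = p' \<odot> (forest_one, \<kappa>)" "(K, \<kappa>) = of_forest K \<odot> (forest_one, \<kappa>)"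
    "fraction Q \<iota> p (K, \<kappa>) = fraction Q \<iota> p' (of_forest K)"
proof
  let ?p' = "p \<odot> (forest_one, inv \<kappa>)"
  have \<kappa>: "\<kappa> \<in> carrier A" "is_forest K" using q by auto
  show p': "?p' \<in> carrier M" using p \<kappa> by (simp add: M_closed is_forest_one)
  show eq1: "p = ?p' \<odot> (forest_one, \<kappa>)"
    using p \<kappa> by (cases p) (simp add: mult_strands m_assoc)
  show eq2: "(K, \<kappa>) = of_forest K \<odot> (forest_one, \<kappa>)" using \<kappa> by (simp add: mult_strands)
  have "fraction Q \<iota> (?p' \<odot> (forest_one, \<kappa>)) (of_forest K \<odot> (forest_one, \<kappa>))
      = fraction Q \<iota> ?p' (of_forest K)"
    using p' \<kappa> by (intro fraction_cancel) (simp_all add: is_forest_one)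
  then show "fraction Q \<iota> p (K, \<kappa>) = fraction Q \<iota> ?p' (of_forest K)"
    by (simp flip: eq1 eq2)
qed

text \<open>Make the denominator of the other representative a forest \<open>K\<close>. A common right multiple of \<open>H\<close> and
  \<open>K\<close> in \<open>M\<close> has as forest part a common right multiple in the forests, and the numerators agree
  after the same expansion. Now \<open>reduced_divides\<close> applies.\<close>

lemma reduced_representatives:
  assumes a: "a \<in> carrier M" and H: "is_forest H" and red: "\<not> reducible a H"
    and p: "p \<in> carrier M" and q: "q \<in> carrier M"
    and eq: "fraction Q \<iota> a (of_forest H) = fraction Q \<iota> p q"
  shows "\<exists>J \<gamma>. is_forest J \<and> \<gamma> \<in> carrier A \<and> p = a \<odot> (J, \<gamma>) \<and> q = of_forest H \<odot> (J, \<gamma>)"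
proof -
  obtain K \<kappa> where q_eq: "q = (K, \<kappa>)" by (cases q)
  then have K: "is_forest K" and \<kappa>: "\<kappa> \<in> carrier A" using q by auto
  obtain p' where p': "p' \<in> carrier M" "p = p' \<odot> (forest_one, \<kappa>)"
    and q': "(K, \<kappa>) = of_forest K \<odot> (forest_one, \<kappa>)"
    and eq': "fraction Q \<iota> p (K, \<kappa>) = fraction Q \<iota> p' (of_forest K)"
    using of_forest_denominator[OF p q[unfolded q_eq]] by blast
  obtain r s where rs: "r \<in> carrier M" "s \<in> carrier M" "of_forest H \<odot> r = of_forest K \<odot> s"
    using common_right_multiple[of "of_forest H" "of_forest K"] H K by auto
  obtain R \<rho> S \<rho>' where "r = (R, \<rho>)" "s = (S, \<rho>')" by (cases r, cases s)
  then have R: "is_forest R" and S: "is_forest S" and HK: "forest_mult H R = forest_mult K S"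
    using rs by (auto simp: of_forest_mult)
  have "a \<odot> of_forest R = p' \<odot> of_forest S"
    using fraction_eqD[of a "of_forest H" p' "of_forest K" "of_forest R" "of_forest S"]
      a H p' K R S HK eq eq' by (simp add: q_eq of_forest_mult)
  then obtain J where J: "is_forest J" "p' = a \<odot> of_forest J" "K = forest_mult H J"
    using reduced_divides[OF a H red p'(1) K R S _ HK] by blast
  have "of_forest J \<odot> (forest_one, \<kappa>) = (J, \<kappa>)" using J(1) \<kappa> by (simp add: mult_strands)
  then have "p = a \<odot> (J, \<kappa>)"
    using p'(2) J a \<kappa> by (simp add: M_assoc is_forest_one)
  moreover have "q = of_forest H \<odot> (J, \<kappa>)" using J \<kappa> by (simp add: q_eq of_forest_mult)
  ultimately show ?thesis using J(1) \<kappa> by blast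
qed

lemma representing_triple_exists:
  assumes "x \<in> carrier Q"
  shows "\<exists>G \<alpha> H. representing_triple A Q \<iota> x G \<alpha> H"
proof -
  obtain p q where pq: "p \<in> carrier M" "q \<in> carrier M" "x = fraction Q \<iota> p q"
    using fractions assms unfolding group_of_right_fractions_def by blast
  obtain K \<kappa> where q_eq: "q = (K, \<kappa>)" by (cases q)
  obtain p' where "p' \<in> carrier M" "x = fraction Q \<iota> p' (of_forest K)"
    using of_forest_denominator[OF pq(1) pq(2)[unfolded q_eq]] pq(3) q_eq by metis
  then show ?thesis using pq(2) q_eq by (cases p') (auto simp: representing_triple_def)
qed

lemma reduced_factor:
  assumes G: "(G, \<alpha>) \<in> carrier M" and H: "is_forest H" and red: "\<not> reducible (G, \<alpha>) H"
    and x: "x = fraction Q \<iota> (G, \<alpha>) (of_forest H)"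
    and rep: "representing_triple A Q \<iota> x L \<delta> K"
  obtains J where "is_forest J" "L = forest_mult G (act \<alpha> J)" "\<delta> = res \<alpha> J" "K = forest_mult H J"
proof -
  have LK: "(L, \<delta>) \<in> carrier M" "of_forest K \<in> carrier M"
    and eq: "fraction Q \<iota> (G, \<alpha>) (of_forest H) = fraction Q \<iota> (L, \<delta>) (of_forest K)"
    using rep x by (auto simp: representing_triple_def)
  obtain J \<gamma> where J: "is_forest J" "\<gamma> \<in> carrier A"
    "(L, \<delta>) = (G, \<alpha>) \<odot> (J, \<gamma>)" "of_forest K = of_forest H \<odot> (J, \<gamma>)"
    using reduced_representatives[OF G H red LK eq] by blast
  then have "\<gamma> = \<one>" "K = forest_mult H J" by (simp_all add: of_forest_mult)
  then show ?thesis using that[of J] J G by (simp add: mult_of_forest)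
qed

text \<open>Acting by \<open>\<alpha>\<close> sends carets to carets, so the forest part of \<open>p' \<odot> of_forest (caret i)\<close> is exactly one
  longer than that of \<open>p'\<close>.\<close>

lemma reducible_shorter:
  assumes "(G, \<alpha>) \<in> carrier M" and "reducible (G, \<alpha>) H"
  shows "\<exists>L \<delta> K. representing_triple A Q \<iota> (fraction Q \<iota> (G, \<alpha>) (of_forest H)) L \<delta> K
    \<and> forest_length L < forest_length G"
proof -
  obtain p K i where p: "p \<in> carrier M" and K: "is_forest K" "H = forest_mult K (caret i)"
    and G: "(G, \<alpha>) = p \<odot> of_forest (caret i)"
    using assms(2) unfolding reducible_def by blast
  obtain L \<delta> where L: "p = (L, \<delta>)" by (cases p)
  have "fraction Q \<iota> (G, \<alpha>) (of_forest H) = fraction Q \<iota> (L, \<delta>) (of_forest K)"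
    using fraction_cancel[of p "of_forest K" "of_forest (caret i)"] p K G L
    by (simp add: of_forest_mult is_forest_caret)
  moreover have "forest_length G = Suc (forest_length L)"
    using G p L by (simp add: mult_caret_M forest_length_mult_caret)
  ultimately show ?thesis
    using p L K by (intro exI[of _ L] exI[of _ \<delta>] exI[of _ K]) (simp add: representing_triple_def)
qed

text \<open>A reducible triple can be shortened. Conversely the numerator of every other triple of \<open>x\<close> is a
  right multiple of that of a reduced one, by \<open>reduced_factor\<close>, and a right multiple is not shorter.\<close>

lemma minimal_iff_reduced:
  "minimal_triple A Q \<iota> x G \<alpha> H \<longleftrightarrow>
    representing_triple A Q \<iota> x G \<alpha> H \<and> \<not> reducible (G, \<alpha>) H"
proof
  assume min: "minimal_triple A Q \<iota> x G \<alpha> H"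
  then have rep: "representing_triple A Q \<iota> x G \<alpha> H" by (simp add: minimal_triple_def)
  then have "(G, \<alpha>) \<in> carrier M" "x = fraction Q \<iota> (G, \<alpha>) (of_forest H)"
    by (simp_all add: representing_triple_def)
  then have "\<not> reducible (G, \<alpha>) H"
    using reducible_shorter[of G \<alpha> H] min unfolding minimal_triple_def by (meson leD)
  then show "representing_triple A Q \<iota> x G \<alpha> H \<and> \<not> reducible (G, \<alpha>) H" using rep by blast
next
  assume *: "representing_triple A Q \<iota> x G \<alpha> H \<and> \<not> reducible (G, \<alpha>) H"
  then have G: "(G, \<alpha>) \<in> carrier M" "is_forest H" "x = fraction Q \<iota> (G, \<alpha>) (of_forest H)"
    by (simp_all add: representing_triple_def)
  have "forest_length G \<le> forest_length L" if "representing_triple A Q \<iota> x L \<delta> K" for L \<delta> K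
    using reduced_factor[OF G(1,2) conjunct2[OF *] G(3) that] G(1)
    by (metis carrier_M forest_length_le_mult is_forest_act)
  then show "minimal_triple A Q \<iota> x G \<alpha> H" using * by (simp add: minimal_triple_def)
qed

text \<open>Two reduced triples divide one another, so the forests \<open>J\<close> and \<open>I\<close> between the denominators satisfy
  \<open>J I = 1\<close>. Then \<open>J\<close> has no inner node.\<close>

lemma minimal_triple_unique:
  assumes "minimal_triple A Q \<iota> x G \<alpha> H" and "minimal_triple A Q \<iota> x L \<delta> K"
  shows "L = G \<and> \<delta> = \<alpha> \<and> K = H"
proof -
  have rep: "representing_triple A Q \<iota> x G \<alpha> H" "representing_triple A Q \<iota> x L \<delta> K"
    and red: "\<not> reducible (G, \<alpha>) H" "\<not> reducible (L, \<delta>) K"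
    using assms by (simp_all add: minimal_iff_reduced)
  then have c: "(G, \<alpha>) \<in> carrier M" "is_forest H" "x = fraction Q \<iota> (G, \<alpha>) (of_forest H)"
    "(L, \<delta>) \<in> carrier M" "is_forest K" "x = fraction Q \<iota> (L, \<delta>) (of_forest K)"
    by (simp_all add: representing_triple_def)
  obtain J where J: "is_forest J" "L = forest_mult G (act \<alpha> J)" "\<delta> = res \<alpha> J" "K = forest_mult H J"
    using reduced_factor[OF c(1,2) red(1) c(3) rep(2)] .
  obtain I where I: "is_forest I" "H = forest_mult K I"
    using reduced_factor[OF c(4,5) red(2) c(6) rep(1)] by metis
  have "forest_mult H (forest_mult J I) = H"
    using forest_assoc[OF c(2) J(1) I(1)] by (simp flip: J(4) I(2))
  then have "forest_mult J I = forest_one"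
    using forest_mult_eq_self c(2) J(1) I(1) is_forest_mult by blast
  then have "inner_nodes J = {}" using inner_nodes_mult[of J I] inner_nodes_one by auto
  then have "J = forest_one" using inner_nodes_empty[OF J(1)] by simp
  then show ?thesis
    using J c act_one[of \<alpha>] res_one[of \<alpha>] by (simp add: one_Forests forest_mult_one)
qed

lemma minimal_triple_ex1:
  assumes "x \<in> carrier Q"
  shows "\<exists>!(G, \<alpha>, H). minimal_triple A Q \<iota> x G \<alpha> H"
proof -
  let ?R = "\<lambda>t. representing_triple A Q \<iota> x (fst t) (fst (snd t)) (snd (snd t))"
  obtain t0 where "?R t0" using representing_triple_exists[OF assms] by fastforce
  then obtain t where t: "?R t" "\<And>t'. ?R t' \<Longrightarrow> forest_length (fst t) \<le> forest_length (fst t')"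
    using ex_has_least_nat[of ?R t0 "\<lambda>t. forest_length (fst t)"] by blast
  obtain G \<alpha> H where t_eq: "t = (G, \<alpha>, H)" by (cases t)
  have min: "minimal_triple A Q \<iota> x G \<alpha> H"
    unfolding minimal_triple_def using t(1) t(2)[of "(_, _, _)"] by (simp add: t_eq)
  show ?thesis
  proof (rule ex1I[of _ "(G, \<alpha>, H)"])
    show "case (G, \<alpha>, H) of (G, \<alpha>, H) \<Rightarrow> minimal_triple A Q \<iota> x G \<alpha> H" using min by simp
    fix s assume s: "case s of (G, \<alpha>, H) \<Rightarrow> minimal_triple A Q \<iota> x G \<alpha> H"
    obtain L \<delta> K where s_eq: "s = (L, \<delta>, K)" by (cases s)
    with s have "minimal_triple A Q \<iota> x L \<delta> K" by simp
    then show "s = (G, \<alpha>, H)" using minimal_triple_unique[OF min] s_eq by blast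
  qed
qed

theorem minimal_triples:
  "(\<forall>x\<in>carrier Q. \<exists>!(G, \<alpha>, H). minimal_triple A Q \<iota> x G \<alpha> H) \<and>
   (\<forall>x\<in>carrier Q. \<forall>G \<alpha> H. minimal_triple A Q \<iota> x G \<alpha> H \<longrightarrow>
     (\<forall>p\<in>carrier M. \<forall>q\<in>carrier M. x = fraction Q \<iota> p q \<longrightarrow>
        (\<exists>J\<in>carrier Forests. \<exists>\<gamma>\<in>carrier A.
           p = (G, \<alpha>) \<odot> (J, \<gamma>) \<and> q = (H, \<one>) \<odot> (J, \<gamma>)))) \<and>
   (\<forall>x\<in>carrier Q. \<forall>G\<in>carrier Forests. \<forall>\<alpha>\<in>carrier A. \<forall>H\<in>carrier Forests.
     minimal_triple A Q \<iota> x G \<alpha> H \<longleftrightarrow>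
     x = fraction Q \<iota> (G, \<alpha>) (H, \<one>) \<and>
     \<not> (\<exists>G'\<in>carrier Forests. \<exists>H'\<in>carrier Forests. \<exists>i. \<exists>\<alpha>'\<in>carrier A.
          (G, \<alpha>) = (G', \<alpha>') \<odot> (caret i, \<one>) \<and> H = H' \<otimes>\<^bsub>Forests\<^esub> caret i))"
proof (intro conjI ballI allI impI)
  fix x assume "x \<in> carrier Q"
  then show "\<exists>!(G, \<alpha>, H). minimal_triple A Q \<iota> x G \<alpha> H" by (rule minimal_triple_ex1)
next
  fix x G \<alpha> H p q
  assume "minimal_triple A Q \<iota> x G \<alpha> H" and pq: "p \<in> carrier M" "q \<in> carrier M" "x = fraction Q \<iota> p q"
  then have "(G, \<alpha>) \<in> carrier M" "is_forest H" "\<not> reducible (G, \<alpha>) H"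
    "fraction Q \<iota> (G, \<alpha>) (of_forest H) = fraction Q \<iota> p q"
    by (auto simp: minimal_iff_reduced representing_triple_def)
  then show "\<exists>J\<in>carrier Forests. \<exists>\<gamma>\<in>carrier A. p = (G, \<alpha>) \<odot> (J, \<gamma>) \<and> q = (H, \<one>) \<odot> (J, \<gamma>)"
    using reduced_representatives[OF _ _ _ pq(1,2)] by fastforce
next
  fix x G \<alpha> H assume "G \<in> carrier Forests" "\<alpha> \<in> carrier A" "H \<in> carrier Forests"
  moreover have "reducible (G, \<alpha>) H \<longleftrightarrow>
      (\<exists>G'\<in>carrier Forests. \<exists>H'\<in>carrier Forests. \<exists>i. \<exists>\<alpha>'\<in>carrier A.
        (G, \<alpha>) = (G', \<alpha>') \<odot> (caret i, \<one>) \<and> H = H' \<otimes>\<^bsub>Forests\<^esub> caret i)"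
    unfolding reducible_def Bex_def split_paired_Ex carrier_M carrier_Forests mult_Forests by blast
  ultimately show "minimal_triple A Q \<iota> x G \<alpha> H \<longleftrightarrow>
     x = fraction Q \<iota> (G, \<alpha>) (H, \<one>) \<and>
     \<not> (\<exists>G'\<in>carrier Forests. \<exists>H'\<in>carrier Forests. \<exists>i. \<exists>\<alpha>'\<in>carrier A.
          (G, \<alpha>) = (G', \<alpha>') \<odot> (caret i, \<one>) \<and> H = H' \<otimes>\<^bsub>Forests\<^esub> caret i)"
    by (simp add: minimal_iff_reduced representing_triple_def)
qed

end

section \<open>Deleting strands of finitary permutations\<close>

lemma bij_perm_gen: "bij (perm_gen q)"
  by (simp add: perm_gen_def)

lemma finite_support_comp:
  assumes "finite {i. f i \<noteq> i}" "finite {i. g i \<noteq> i}"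
  shows "finite {i. (f \<circ> g) i \<noteq> i}"
  by (rule finite_subset[OF _ finite_UnI[OF assms]]) auto

lemma finite_support_inv:
  assumes "bij f" "finite {i. f i \<noteq> i}"
  shows "finite {i. inv_into UNIV f i \<noteq> i}"
proof (rule finite_subset[OF _ assms(2)])
  show "{i. inv_into UNIV f i \<noteq> i} \<subseteq> {i. f i \<noteq> i}"
    using assms(1) by (auto simp: bij_is_inj inv_f_eq)
qed

lemma finite_support_perm_gen: "finite {i. perm_gen q i \<noteq> i}"
  by (rule finite_subset[of _ "{q, Suc q}"]) (auto simp: perm_gen_def transpose_def)

lemma carrier_S_inf: "p \<in> carrier S_inf \<longleftrightarrow> bij p \<and> finite {i. p i \<noteq> i}"
  by (simp add: S_inf_def)

lemma mult_S_inf: "p \<otimes>\<^bsub>S_inf\<^esub> q = p \<circ> q"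
  and one_S_inf: "\<one>\<^bsub>S_inf\<^esub> = id"
  by (simp_all only: S_inf_def monoid.simps)

lemma group_S_inf: "group S_inf"
proof (rule groupI)
  fix p assume p: "p \<in> carrier S_inf"
  show "\<exists>q\<in>carrier S_inf. q \<otimes>\<^bsub>S_inf\<^esub> p = \<one>\<^bsub>S_inf\<^esub>"
    using p by (intro bexI[of _ "inv_into UNIV p"])
      (simp_all add: S_inf_def finite_support_inv bij_imp_bij_inv bij_is_inj)
qed (auto simp: S_inf_def bij_comp finite_support_comp comp_assoc simp del: comp_apply)

lemma perm_gen_in_S_inf: "perm_gen q \<in> carrier S_inf"
  by (simp add: carrier_S_inf bij_perm_gen finite_support_perm_gen)

lemma perm_gen_comp_self: "perm_gen q \<circ> (perm_gen q \<circ> p) = p"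
  by (simp add: perm_gen_def fun_eq_iff)

text \<open>The largest position that \<open>p\<close> moves is put right by composing with adjacent transpositions, one for
  each step between its value and its place, as in bubble sort.\<close>

lemma finitary_perm_induct [consumes 2, case_names id gen]:
  assumes p: "bij p" "finite {i. p i \<noteq> i}" and one: "P id"
    and gen: "\<And>q p. bij p \<Longrightarrow> P p \<Longrightarrow> P (perm_gen q \<circ> p)"
  shows "P p"
proof -
  have fixed_above: "P p" if "bij p" "\<And>i. n \<le> i \<Longrightarrow> p i = i" for n p
    using that
  proof (induction n arbitrary: p)
    case 0
    then have "p = id" by auto
    then show ?case using one by (simp only:)
  next
    case (Suc n)
    have "P p" if "bij p" "\<And>i. Suc n \<le> i \<Longrightarrow> p i = i" "p n + d = n" for d p
      using that
    proof (induction d arbitrary: p)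
      case 0
      then have "p i = i" if "n \<le> i" for i using that by (cases "i = n") auto
      then show ?case using Suc.IH "0.prems"(1) by blast
    next
      case (Suc d)
      let ?s = "perm_gen (p n)"
      have "bij (?s \<circ> p)" using Suc.prems(1) bij_perm_gen bij_comp by blast
      moreover have "(?s \<circ> p) i = i" if "Suc n \<le> i" for i
        using Suc.prems that by (simp add: perm_gen_def transpose_def)
      moreover have "(?s \<circ> p) n + d = n" using Suc.prems(3) by (simp add: perm_gen_def)
      ultimately have "P (?s \<circ> p)" "bij (?s \<circ> p)" using Suc.IH by blast+
      then have "P (?s \<circ> (?s \<circ> p))" by (rule gen[rotated])
      then show ?case by (simp only: perm_gen_comp_self)
    qed
    moreover have "p n \<le> n"
    proof (rule ccontr)
      assume "\<not> p n \<le> n"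
      then have "p (p n) = p n" using Suc.prems(2) by simp
      then show False using Suc.prems(1) \<open>\<not> p n \<le> n\<close> by (simp add: bij_is_inj inj_eq)
    qed
    then have "p n + (n - p n) = n" by simp
    ultimately show ?case using Suc.prems by blast
  qed
  obtain n where "\<And>i. p i \<noteq> i \<Longrightarrow> i < n"
    using p(2) unfolding finite_nat_set_iff_bounded by blast
  then show ?thesis using fixed_above[OF p(1), of n] by (metis leD)
qed

lemma generate_S_inf: "generate S_inf (range perm_gen) = carrier S_inf"
proof
  interpret group S_inf by (rule group_S_inf)
  show "generate S_inf (range perm_gen) \<subseteq> carrier S_inf"
    using generate_incl perm_gen_in_S_inf by blast
  show "carrier S_inf \<subseteq> generate S_inf (range perm_gen)"
  proof
    fix p assume "p \<in> carrier S_inf"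
    then have "bij p" "finite {i. p i \<noteq> i}" by (simp_all add: carrier_S_inf)
    then show "p \<in> generate S_inf (range perm_gen)"
    proof (induction rule: finitary_perm_induct)
      case id
      show ?case using generate.one[of S_inf "range perm_gen"] unfolding one_S_inf .
    next
      case (gen q p)
      show ?case
        using generate.eng[OF generate.incl[OF rangeI] gen(2)] unfolding mult_S_inf .
    qed
  qed
qed

text \<open>\<open>p\<close> read off between \<open>\<nat> - {j}\<close> and \<open>\<nat> - {p j}\<close>, both renumbered in increasing order.\<close>

definition perm_del :: "(nat \<Rightarrow> nat) \<Rightarrow> nat \<Rightarrow> nat \<Rightarrow> nat" where
  "perm_del p j k = drop_strand (p j) (p (add_strand j k))"

lemma perm_del_comp:
  assumes "inj p" "inj q"
  shows "perm_del (p \<circ> q) j = perm_del p (q j) \<circ> perm_del q j"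
proof
  fix k
  have "add_strand j k \<noteq> j" by (simp add: add_strand_def)
  then have "q (add_strand j k) \<noteq> q j" using assms(2) by (simp add: inj_eq)
  then have "add_strand (q j) (drop_strand (q j) (q (add_strand j k))) = q (add_strand j k)"
    by (auto simp: add_strand_def drop_strand_def)
  then show "perm_del (p \<circ> q) j k = (perm_del p (q j) \<circ> perm_del q j) k"
    by (simp add: perm_del_def)
qed

lemma perm_del_id: "perm_del id j = id"
  by (auto simp: fun_eq_iff perm_del_def drop_strand_def add_strand_def)

lemma perm_del_gen:
  "perm_del (perm_gen q) j = (if j < q then perm_gen (q - 1) else if j \<le> q + 1 then id else perm_gen q)"
proof
  fix k
  have "drop_strand j (add_strand j k) = k" "add_strand j k \<noteq> j"
    by (auto simp: drop_strand_def add_strand_def)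
  then show "perm_del (perm_gen q) j k =
      (if j < q then perm_gen (q - 1) else if j \<le> q + 1 then id else perm_gen q) k"
    using perm_gen_drop_strand[of "add_strand j k" j q] by (simp add: perm_del_def split: if_splits)
qed

text \<open>Bijectivity and finite support pass through products by \<open>perm_del_comp\<close>, so it suffices to look at
  adjacent transpositions.\<close>

lemma perm_del_closed:
  assumes "p \<in> carrier S_inf"
  shows "perm_del p j \<in> carrier S_inf"
proof -
  interpret group S_inf by (rule group_S_inf)
  have id: "id \<in> carrier S_inf" using one_closed unfolding one_S_inf .
  have comp: "f \<circ> g \<in> carrier S_inf" if "f \<in> carrier S_inf" "g \<in> carrier S_inf" for f g
    using m_closed[OF that] unfolding mult_S_inf .
  have "bij p" "finite {i. p i \<noteq> i}" using assms by (simp_all add: carrier_S_inf)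
  then have "\<forall>j. perm_del p j \<in> carrier S_inf"
  proof (induction rule: finitary_perm_induct)
    case id
    show ?case unfolding perm_del_id using \<open>id \<in> carrier S_inf\<close> ..
  next
    case (gen q p)
    have "perm_del (perm_gen q) j \<in> carrier S_inf" for j
      unfolding perm_del_gen using id perm_gen_in_S_inf by (simp split del: if_split split: if_split)
    then show ?case
      unfolding perm_del_comp[OF bij_is_inj[OF bij_perm_gen] bij_is_inj[OF gen(1)]]
      using gen(2) comp by blast
  qed
  then show ?thesis ..
qed

lemma strand_group_S_inf: "strand_group S_inf perm_gen (\<lambda>p. p) perm_del"
proof (intro strand_group.intro strand_group_axioms.intro)
  show "group S_inf" by (rule group_S_inf)
  show "generate S_inf (range perm_gen) = carrier S_inf" by (rule generate_S_inf)
  show "perm_del p j \<in> carrier S_inf" if "p \<in> carrier S_inf" for p j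
    using that by (rule perm_del_closed)
  show "perm_del (p \<otimes>\<^bsub>S_inf\<^esub> q) j = perm_del p (q j) \<otimes>\<^bsub>S_inf\<^esub> perm_del q j"
    if "p \<in> carrier S_inf" "q \<in> carrier S_inf" for p q j
    using perm_del_comp[of p q j] that by (simp add: S_inf_def bij_is_inj)
qed (simp_all add: S_inf_def perm_del_gen)

section \<open>Deleting strands of braids\<close>

fun word_perm :: "(nat \<times> bool) list \<Rightarrow> nat \<Rightarrow> nat" where
  "word_perm [] = id"
| "word_perm ((q, b) # w) = perm_gen q \<circ> word_perm w"

text \<open>A crossing disappears with either of its strands and moves one place to the left if the deleted strand
  lies to its left.\<close>

definition letter_del :: "nat \<times> bool \<Rightarrow> nat \<Rightarrow> (nat \<times> bool) list" where
  "letter_del l j = (if j < fst l then [(fst l - 1, snd l)] else if j \<le> fst l + 1 then [] else [l])"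

text \<open>The last letter of a word acts first, so the strand that \<open>w\<close> moves to \<open>word_perm w j\<close> is the one to be
  deleted from the letter in front of \<open>w\<close>.\<close>

fun word_del :: "(nat \<times> bool) list \<Rightarrow> nat \<Rightarrow> (nat \<times> bool) list" where
  "word_del [] j = []"
| "word_del (l # w) j = letter_del l (word_perm w j) @ word_del w j"

lemma word_perm_append: "word_perm (u @ v) = word_perm u \<circ> word_perm v"
  by (induction u rule: word_perm.induct) (auto simp: fun_eq_iff)

lemma word_del_append: "word_del (u @ v) j = word_del u (word_perm v j) @ word_del v j"
  by (induction u) (simp_all add: word_perm_append)

lemma perm_gen_eq: "perm_gen q k = (if k = q then Suc q else if k = Suc q then q else k)"
  by (simp add: perm_gen_def transpose_def)

lemma word_perm_braid_eq:
  assumes "braid_eq u v"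
  shows "word_perm u = word_perm v"
  using assms
proof induction
  case (cong u u' v v') then show ?case by (simp add: word_perm_append)
next
  case (commute m n) then show ?case by (auto simp: fun_eq_iff perm_gen_eq)
qed (auto simp: fun_eq_iff perm_gen_eq)

text \<open>Each defining relation turns, when a strand is deleted, into a relation of the same kind with fewer
  or renumbered letters, or into an equality of words.\<close>

lemma word_del_braid_eq:
  assumes "braid_eq u v"
  shows "braid_eq (word_del u j) (word_del v j)"
  using assms
proof (induction arbitrary: j)
  case (cong u u' v v')
  then show ?case by (simp add: word_del_append word_perm_braid_eq braid_eq.cong)
next
  case (cancel m b)
  consider "j < m" | "j = m" | "j = Suc m" | "Suc m < j" by linarith
  then show ?case
    by cases (simp_all add: letter_del_def perm_gen_eq braid_eq.refl braid_eq.cancel)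
next
  case (commute m n)
  \<comment> \<open>A strand between the two crossings brings them closer together, but it lies between them only if
    \<open>n \<ge> m + 3\<close>.\<close>
  have *: "braid_eq (word_del [(m, True), (n, True)] j) (word_del [(n, True), (m, True)] j)"
    if "m + 2 \<le> n" for m n
  proof -
    consider "j < m" | "j = m" | "j = Suc m" | "Suc m < j" "j < n" | "j = n" | "j = Suc n" | "Suc n < j"
      by linarith
    then show ?thesis
    proof cases
      case 1
      then have "braid_eq [(m - 1, True), (n - 1, True)] [(n - 1, True), (m - 1, True)]"
        using that by (intro braid_eq.commute) arith
      then show ?thesis using 1 that by (simp add: letter_del_def perm_gen_eq)
    next
      case 4
      then have "braid_eq [(m, True), (n - 1, True)] [(n - 1, True), (m, True)]"
        by (intro braid_eq.commute) arith
      then show ?thesis using 4 that by (simp add: letter_del_def perm_gen_eq)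
    next
      case 7
      then have "braid_eq [(m, True), (n, True)] [(n, True), (m, True)]"
        using that by (intro braid_eq.commute) arith
      then show ?thesis using 7 that by (simp add: letter_del_def perm_gen_eq)
    qed (use that in \<open>simp_all add: letter_del_def perm_gen_eq braid_eq.refl\<close>)
  qed
  consider "m + 2 \<le> n" | "n + 2 \<le> m" using commute by linarith
  then show ?case using * by cases (auto intro: braid_eq.sym)
next
  case (braid m)
  consider "j < m" | "j = m" | "j = Suc m" | "j = Suc (Suc m)" | "Suc (Suc m) < j" by linarith
  then show ?case
  proof cases
    case 1
    then show ?thesis using braid_eq.braid[of "m - 1"] by (simp add: letter_del_def perm_gen_eq)
  qed (simp_all add: letter_del_def perm_gen_eq braid_eq.refl braid_eq.braid)
qed (auto intro: braid_eq.intros)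

lift_definition braid_perm :: "braid \<Rightarrow> nat \<Rightarrow> nat" is word_perm
  by (rule word_perm_braid_eq)

lift_definition braid_del :: "braid \<Rightarrow> nat \<Rightarrow> braid" is word_del
  by (rule word_del_braid_eq)

lift_definition braid_letter :: "nat \<times> bool \<Rightarrow> braid" is "\<lambda>l. [l]" .

lemma braid_induct [case_names one letter]:
  assumes "P braid_one" and "\<And>l \<alpha>. P \<alpha> \<Longrightarrow> P (braid_mult (braid_letter l) \<alpha>)"
  shows "P \<alpha>"
proof -
  have "P (abs_braid w)" for w
  proof (induction w)
    case Nil then show ?case using assms(1) by (simp add: braid_one_def)
  next
    case (Cons l w)
    then show ?case
      using assms(2)[of "abs_braid w" l] by (simp add: braid_mult.abs_eq braid_letter.abs_eq)
  qed
  then show ?thesis by (metis Quotient_abs_rep[OF Quotient_braid])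
qed

lemma braid_mult_assoc: "braid_mult (braid_mult \<alpha> \<beta>) \<gamma> = braid_mult \<alpha> (braid_mult \<beta> \<gamma>)"
  by transfer (simp add: braid_eq.refl)

lemma braid_one_mult: "braid_mult braid_one \<alpha> = \<alpha>"
  by transfer (simp add: braid_eq.refl)

lemma braid_letter_cancel: "braid_mult (braid_letter (q, b)) (braid_letter (q, \<not> b)) = braid_one"
  by transfer (simp add: braid_eq.cancel)

lemma group_B_inf: "group B_inf"
proof (rule groupI)
  fix \<alpha>
  have "\<exists>\<beta>. braid_mult \<beta> \<alpha> = braid_one"
  proof (induction \<alpha> rule: braid_induct)
    case one show ?case using braid_one_mult by blast
  next
    case (letter l \<alpha>)
    then obtain \<beta> where \<beta>: "braid_mult \<beta> \<alpha> = braid_one" by blast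
    obtain q b where l: "l = (q, b)" by (cases l)
    have "braid_mult (braid_mult \<beta> (braid_letter (q, \<not> b))) (braid_mult (braid_letter l) \<alpha>)
        = braid_mult \<beta> (braid_mult (braid_mult (braid_letter (q, \<not> b)) (braid_letter (q, \<not> \<not> b))) \<alpha>)"
      by (simp add: l braid_mult_assoc)
    also have "\<dots> = braid_one" by (simp only: braid_letter_cancel braid_one_mult \<beta>)
    finally show ?case by blast
  qed
  then show "\<exists>\<beta>\<in>carrier B_inf. \<beta> \<otimes>\<^bsub>B_inf\<^esub> \<alpha> = \<one>\<^bsub>B_inf\<^esub>" by (simp add: B_inf_def)
qed (simp_all add: B_inf_def braid_mult_assoc braid_one_mult)

lemma generate_B_inf: "generate B_inf (range braid_gen) = carrier B_inf"
proof -
  interpret group B_inf by (rule group_B_inf)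
  have gen: "braid_letter (q, True) = braid_gen q" for q
    by transfer (rule braid_eq.refl)
  have "braid_letter (q, False) = inv\<^bsub>B_inf\<^esub> (braid_gen q)" for q
    using inv_equality[of "braid_letter (q, False)" "braid_gen q"] braid_letter_cancel[of q False]
    by (simp add: B_inf_def gen)
  then have letters: "braid_letter l \<in> generate B_inf (range braid_gen)" for l
    using generate.incl[of _ "range braid_gen" B_inf] generate.inv[of _ "range braid_gen" B_inf] gen
    by (cases l; cases "snd l") auto
  have "\<alpha> \<in> generate B_inf (range braid_gen)" for \<alpha>
  proof (induction \<alpha> rule: braid_induct)
    case one show ?case using generate.one[of B_inf "range braid_gen"] by (simp add: B_inf_def)
  next
    case (letter l \<alpha>)
    show ?case using generate.eng[OF letters[of l] letter.IH] by (simp add: B_inf_def)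
  qed
  then show ?thesis by (auto simp: B_inf_def)
qed

lemma strand_group_B_inf: "strand_group B_inf braid_gen braid_perm braid_del"
proof (intro strand_group.intro strand_group_axioms.intro)
  show "group B_inf" by (rule group_B_inf)
  show "generate B_inf (range braid_gen) = carrier B_inf" by (rule generate_B_inf)
  have "braid_perm (braid_mult \<alpha> \<beta>) i = braid_perm \<alpha> (braid_perm \<beta> i)" for \<alpha> \<beta> i
    by transfer (simp add: word_perm_append)
  then show "braid_perm (\<alpha> \<otimes>\<^bsub>B_inf\<^esub> \<beta>) i = braid_perm \<alpha> (braid_perm \<beta> i)" for \<alpha> \<beta> i
    by (simp add: B_inf_def)
  have "braid_del (braid_mult \<alpha> \<beta>) j = braid_mult (braid_del \<alpha> (braid_perm \<beta> j)) (braid_del \<beta> j)"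
    for \<alpha> \<beta> j
    by transfer (simp add: word_del_append braid_eq.refl)
  then show "braid_del (\<alpha> \<otimes>\<^bsub>B_inf\<^esub> \<beta>) j = braid_del \<alpha> (braid_perm \<beta> j) \<otimes>\<^bsub>B_inf\<^esub> braid_del \<beta> j"
    for \<alpha> \<beta> j
    by (simp add: B_inf_def)
  show "braid_perm (braid_gen q) = perm_gen q" for q by transfer simp
  have "braid_del (braid_gen q) j =
      (if j < q then braid_gen (q - 1) else if j \<le> q + 1 then braid_one else braid_gen q)" for q j
    by transfer (simp add: letter_del_def braid_eq.refl)
  then show "braid_del (braid_gen q) j =
      (if j < q then braid_gen (q - 1) else if j \<le> q + 1 then \<one>\<^bsub>B_inf\<^esub> else braid_gen q)" for q j
    by (simp add: B_inf_def)
qed (simp add: B_inf_def)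

theorem theorem2:
  fixes V :: "'v monoid" and BV :: "'b monoid"
    and \<iota> :: "forest \<times> (nat \<Rightarrow> nat) \<Rightarrow> 'v" and \<kappa> :: "forest \<times> braid \<Rightarrow> 'b"
  assumes "zappa_szep S_inf perm_gen act res"
    and "group_of_right_fractions (zs_product S_inf act res) V \<iota>"
    and "zappa_szep B_inf braid_gen bact bres"
    and "group_of_right_fractions (zs_product B_inf bact bres) BV \<kappa>"
  shows
    "(\<forall>x\<in>carrier V. \<exists>!(G, \<alpha>, H). minimal_triple S_inf V \<iota> x G \<alpha> H) \<and>
     (\<forall>x\<in>carrier V. \<forall>G \<alpha> H. minimal_triple S_inf V \<iota> x G \<alpha> H \<longrightarrow>
       (\<forall>p\<in>carrier (zs_product S_inf act res). \<forall>q\<in>carrier (zs_product S_inf act res).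
          x = fraction V \<iota> p q \<longrightarrow>
          (\<exists>J\<in>carrier Forests. \<exists>\<gamma>\<in>carrier S_inf.
             p = (G, \<alpha>) \<otimes>\<^bsub>zs_product S_inf act res\<^esub> (J, \<gamma>) \<and>
             q = (H, \<one>\<^bsub>S_inf\<^esub>) \<otimes>\<^bsub>zs_product S_inf act res\<^esub> (J, \<gamma>)))) \<and>
     (\<forall>x\<in>carrier V. \<forall>G\<in>carrier Forests. \<forall>\<alpha>\<in>carrier S_inf. \<forall>H\<in>carrier Forests.
       minimal_triple S_inf V \<iota> x G \<alpha> H \<longleftrightarrow>
       x = fraction V \<iota> (G, \<alpha>) (H, \<one>\<^bsub>S_inf\<^esub>) \<and>
       \<not> (\<exists>G'\<in>carrier Forests. \<exists>H'\<in>carrier Forests. \<exists>i. \<exists>\<alpha>'\<in>carrier S_inf.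
            (G, \<alpha>) = (G', \<alpha>') \<otimes>\<^bsub>zs_product S_inf act res\<^esub> (caret i, \<one>\<^bsub>S_inf\<^esub>) \<and>
            H = H' \<otimes>\<^bsub>Forests\<^esub> caret i)) \<and>
     (\<forall>x\<in>carrier BV. \<exists>!(G, \<alpha>, H). minimal_triple B_inf BV \<kappa> x G \<alpha> H) \<and>
     (\<forall>x\<in>carrier BV. \<forall>G \<alpha> H. minimal_triple B_inf BV \<kappa> x G \<alpha> H \<longrightarrow>
       (\<forall>p\<in>carrier (zs_product B_inf bact bres). \<forall>q\<in>carrier (zs_product B_inf bact bres).
          x = fraction BV \<kappa> p q \<longrightarrow>
          (\<exists>J\<in>carrier Forests. \<exists>\<gamma>\<in>carrier B_inf.
             p = (G, \<alpha>) \<otimes>\<^bsub>zs_product B_inf bact bres\<^esub> (J, \<gamma>) \<and>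
             q = (H, \<one>\<^bsub>B_inf\<^esub>) \<otimes>\<^bsub>zs_product B_inf bact bres\<^esub> (J, \<gamma>)))) \<and>
     (\<forall>x\<in>carrier BV. \<forall>G\<in>carrier Forests. \<forall>\<alpha>\<in>carrier B_inf. \<forall>H\<in>carrier Forests.
       minimal_triple B_inf BV \<kappa> x G \<alpha> H \<longleftrightarrow>
       x = fraction BV \<kappa> (G, \<alpha>) (H, \<one>\<^bsub>B_inf\<^esub>) \<and>
       \<not> (\<exists>G'\<in>carrier Forests. \<exists>H'\<in>carrier Forests. \<exists>i. \<exists>\<alpha>'\<in>carrier B_inf.
            (G, \<alpha>) = (G', \<alpha>') \<otimes>\<^bsub>zs_product B_inf bact bres\<^esub> (caret i, \<one>\<^bsub>B_inf\<^esub>) \<and>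
            H = H' \<otimes>\<^bsub>Forests\<^esub> caret i))"
proof -
  interpret S: strand_group S_inf perm_gen "\<lambda>p. p" perm_del by (rule strand_group_S_inf)
  interpret S_zs: zappa_szep S_inf perm_gen act res by (rule assms(1))
  interpret S_zs: zs_fractions S_inf perm_gen act res "\<lambda>p. p" perm_del V \<iota>
    by unfold_locales (rule assms(2))
  interpret B: strand_group B_inf braid_gen braid_perm braid_del by (rule strand_group_B_inf)
  interpret B_zs: zappa_szep B_inf braid_gen bact bres by (rule assms(3))
  interpret B_zs: zs_fractions B_inf braid_gen bact bres braid_perm braid_del BV \<kappa>
    by unfold_locales (rule assms(4))
  show ?thesis
    using S_zs.minimal_triples B_zs.minimal_triples by (elim conjE, intro conjI)
qed

end
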